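(* Let $g_0=dr^2+f(r)^2d\theta^2$ be a smooth rotationally symmetric metric on $M=\mathbb{S}^1\times[-\rho,\rho]$ with $A_{g_0}(M)=1$, $R_{g_0}\ge0$ and $k_{g_0}\le0$. Then for every $T<\infty$ there is a constant $C(g_0,T)$ such that the scalar curvature of the normalised flow starting at $g_0$ satisfies $R\le C(g_0,T)$ on $M\times(0,T)$ (for as long as the flow is defined on $(0,T)$).
   Context: $R$ denotes scalar curvature (twice the Gauss curvature), $k_g$ the geodesic curvature of $\partial M$ w.r.t. the outward normal. The unnormalised flow solves $\partial_{\tilde t}\tilde g=-\tilde R\tilde g$, $k_{\tilde g}=k_{g_0}$ on $\partial M$, $\tilde g(0)=g_0$. The normalised flow is $g=\phi\tilde g$ with $\phi$ chosen so that $A_g(M)=1$, reparametrised by $t=\int_0^{\tilde t}\phi$; it solves $\partial_t g=(r-R)g$, $k_g=k_{g_0}/\sqrt{\phi}$ on $\partial M$, $g(0)=g_0$, with $r=\int_M R\,dA_g$. Rotational symmetry is preserved by the flow. *)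

theory Defs
  imports "HOL-Analysis.Analysis"
begin

text \<open>
Rotationally symmetric setting. The background metric is
g0 = dr^2 + f(r)^2 dtheta^2 on M = S^1 x [-rho, rho].
Along the (conformal, rotationally symmetric) flow the metric is
g(t) = u(r,t) g0 with u > 0, so every geometric quantity is expressed
through the profile f and the conformal factor u.
\<close>

definition smooth_profile :: "(real \<Rightarrow> real) \<Rightarrow> real \<Rightarrow> bool" where
  "smooth_profile f \<rho> \<longleftrightarrow>
     (\<exists>U. open U \<and> {-\<rho>..\<rho>} \<subseteq> U \<and>
          (\<forall>n. \<forall>x\<in>U. ((deriv ^^ n) f) differentiable (at x)))"

definition pd_r :: "real \<Rightarrow> (real \<Rightarrow> real \<Rightarrow> real) \<Rightarrow> real \<Rightarrow> real \<Rightarrow> real" where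
  "pd_r \<rho> h r t = vector_derivative (\<lambda>s. h s t) (at r within {-\<rho>..\<rho>})"

definition pd_t :: "real \<Rightarrow> (real \<Rightarrow> real \<Rightarrow> real) \<Rightarrow> real \<Rightarrow> real \<Rightarrow> real" where
  "pd_t T h r t = vector_derivative (\<lambda>\<tau>. h r \<tau>) (at t within {0..<T})"

definition scal0 :: "(real \<Rightarrow> real) \<Rightarrow> real \<Rightarrow> real" where
  "scal0 f r = - 2 * deriv (deriv f) r / f r"

text \<open>Laplacian of g0 on rotationally symmetric functions: (1/f)(f h_r)_r.\<close>
definition lap0 :: "(real \<Rightarrow> real) \<Rightarrow> real \<Rightarrow> (real \<Rightarrow> real \<Rightarrow> real) \<Rightarrow> real \<Rightarrow> real \<Rightarrow> real" where
  "lap0 f \<rho> h r t = pd_r \<rho> (pd_r \<rho> h) r t + deriv f r / f r * pd_r \<rho> h r t"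

definition scal :: "(real \<Rightarrow> real) \<Rightarrow> real \<Rightarrow> (real \<Rightarrow> real \<Rightarrow> real) \<Rightarrow> real \<Rightarrow> real \<Rightarrow> real" where
  "scal f \<rho> u r t = (scal0 f r - lap0 f \<rho> (\<lambda>r t. ln (u r t)) r t) / u r t"

definition area :: "(real \<Rightarrow> real) \<Rightarrow> real \<Rightarrow> (real \<Rightarrow> real \<Rightarrow> real) \<Rightarrow> real \<Rightarrow> real" where
  "area f \<rho> u t = 2 * pi * integral {-\<rho>..\<rho>} (\<lambda>r. u r t * f r)"

definition rbar :: "(real \<Rightarrow> real) \<Rightarrow> real \<Rightarrow> (real \<Rightarrow> real \<Rightarrow> real) \<Rightarrow> real \<Rightarrow> real" where
  "rbar f \<rho> u t = 2 * pi * integral {-\<rho>..\<rho>} (\<lambda>r. scal f \<rho> u r t * u r t * f r)"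

text \<open>Sign of the outward normal d/dr at the boundary circles r = rho and r = -rho.\<close>
definition nu :: "real \<Rightarrow> real \<Rightarrow> real" where
  "nu \<rho> r = (if r = \<rho> then 1 else -1)"

definition kgeo0 :: "(real \<Rightarrow> real) \<Rightarrow> real \<Rightarrow> real \<Rightarrow> real" where
  "kgeo0 f \<rho> r = nu \<rho> r * deriv f r / f r"

text \<open>Geodesic curvature for g = e^{2w} g0, w = (ln u)/2:
  k_g = e^{-w} (k_{g0} + d w / d nu).\<close>
definition kgeo :: "(real \<Rightarrow> real) \<Rightarrow> real \<Rightarrow> (real \<Rightarrow> real \<Rightarrow> real) \<Rightarrow> real \<Rightarrow> real \<Rightarrow> real" where
  "kgeo f \<rho> u r t =
     (kgeo0 f \<rho> r + nu \<rho> r * pd_r \<rho> (\<lambda>r t. ln (u r t)) r t / 2) / sqrt (u r t)"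

text \<open>Rescaling factor phi, determined by phi(0)=1 and (d/dt) phi = r(t) phi
  (equivalent to the definition via the unnormalised flow).\<close>
definition phi :: "(real \<Rightarrow> real) \<Rightarrow> real \<Rightarrow> (real \<Rightarrow> real \<Rightarrow> real) \<Rightarrow> real \<Rightarrow> real" where
  "phi f \<rho> u t = exp (integral {0..t} (\<lambda>s. rbar f \<rho> u s))"

definition normalised_flow ::
  "(real \<Rightarrow> real) \<Rightarrow> real \<Rightarrow> real \<Rightarrow> (real \<Rightarrow> real \<Rightarrow> real) \<Rightarrow> bool" where
  "normalised_flow f \<rho> T u \<longleftrightarrow>
     (\<forall>r\<in>{-\<rho>..\<rho>}. u r 0 = 1) \<and>
     (\<forall>r\<in>{-\<rho>..\<rho>}. \<forall>t\<in>{0..<T}. 0 < u r t) \<and>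
     continuous_on ({-\<rho>..\<rho>} \<times> {0..<T}) (\<lambda>(r, t). u r t) \<and>
     (\<forall>r\<in>{-\<rho>..\<rho>}. \<forall>t\<in>{0..<T}.
         (\<lambda>s. u s t) differentiable (at r within {-\<rho>..\<rho>}) \<and>
         (\<lambda>s. pd_r \<rho> u s t) differentiable (at r within {-\<rho>..\<rho>}) \<and>
         (\<lambda>\<tau>. u r \<tau>) differentiable (at t within {0..<T})) \<and>
     continuous_on ({-\<rho>..\<rho>} \<times> {0..<T}) (\<lambda>(r, t). pd_r \<rho> u r t) \<and>
     continuous_on ({-\<rho>..\<rho>} \<times> {0..<T}) (\<lambda>(r, t). pd_r \<rho> (pd_r \<rho> u) r t) \<and>
     continuous_on ({-\<rho>..\<rho>} \<times> {0..<T}) (\<lambda>(r, t). pd_t T u r t) \<and>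
     (\<forall>t\<in>{0..<T}. area f \<rho> u t = 1) \<and>
     (\<forall>r\<in>{-\<rho>..\<rho>}. \<forall>t\<in>{0..<T}.
         pd_t T u r t = (rbar f \<rho> u t - scal f \<rho> u r t) * u r t) \<and>
     (\<forall>r\<in>{-\<rho>, \<rho>}. \<forall>t\<in>{0..<T}.
         kgeo f \<rho> u r t = kgeo0 f \<rho> r / sqrt (phi f \<rho> u t))"

end

theory Submission
  imports Defs
begin

text \<open>
In the coordinate \<open>s\<close> with \<open>ds = dr / f\<close> and in the time of the unnormalised flow, the metric is
\<open>exp z (ds\<^sup>2 + d\<theta>\<^sup>2)\<close> with \<open>z\<^sub>t = exp (-z) z\<^sub>s\<^sub>s\<close> and \<open>z\<^sub>s = c exp (z / 2)\<close> at the ends, where \<open>c\<close> has the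
sign of \<open>k_g\<close> in the outward direction. The maximum principle for \<open>z\<close> and for \<open>y = z\<^sub>s\<close> bounds \<open>z\<close> from above
and \<open>\<bar>y\<bar>\<close>. By Gauss--Bonnet \<open>r(t)\<close> is then bounded, so up to time \<open>T\<close> the unnormalised area stays bounded
below, and with the bound on \<open>y\<close> so does \<open>z\<close>. The curvature \<open>q = - z\<^sub>t\<close> satisfies
\<open>q\<^sub>t = exp (-z) q\<^sub>s\<^sub>s + q\<^sup>2\<close>; adding \<open>A (y - a exp (z / 2))\<^sup>2\<close> with \<open>a\<close> affine and equal to \<open>c\<close> at the ends
produces a term beating \<open>q\<^sup>2\<close> without disturbing the boundary condition \<open>\<partial>\<^sub>\<nu> q = (c / 2) exp (z / 2) q\<close>, and
the maximum principle bounds the sum.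

The flow is only \<open>C\<^sup>2\<close> in space and \<open>C\<^sup>1\<close> in time, so \<open>q\<close> cannot be differentiated. Instead \<open>q\<close>, \<open>y\<close> and
\<open>exp (z / 2)\<close> are averaged over \<open>[t, t + h]\<close>: since \<open>(exp z)\<^sub>t = z\<^sub>s\<^sub>s\<close> is linear in the averaged quantity,
the averages are smooth enough and satisfy closed difference versions of the same equations, and \<open>h \<rightarrow> 0\<close>
at the maximum points.
\<close>

section \<open>Reparametrisation, maxima and time averages\<close>

lemma DERIV_chain_within:
  fixes F g :: "real \<Rightarrow> real"
  assumes "(F has_real_derivative D) (at (g x) within B)" "g ` A \<subseteq> B"
    "(g has_real_derivative D') (at x within A)"
  shows "((\<lambda>x. F (g x)) has_real_derivative D * D') (at x within A)"
  using DERIV_image_chain[OF DERIV_subset[OF assms(1,2)] assms(3)] by (simp add: o_def)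

lemma mvt_within:
  fixes F :: "real \<Rightarrow> real"
  assumes "a < b" "{a..b} \<subseteq> A"
    and "\<And>x. x \<in> {a..b} \<Longrightarrow> (F has_real_derivative F' x) (at x within A)"
  obtains \<xi> where "a < \<xi>" "\<xi> < b" "F b - F a = F' \<xi> * (b - a)"
proof -
  have "\<exists>x\<in>{a<..<b}. F b - F a = F' x * (b - a)"
    using assms by (intro mvt_simple[where f' = "\<lambda>x h. F' x * h"])
      (auto simp: has_field_derivative_def intro: has_derivative_subset)
  then show thesis using that by auto
qed

lemma lipschitz_within:
  fixes F :: "real \<Rightarrow> real"
  assumes der: "\<And>x. x \<in> {a..b} \<Longrightarrow> (F has_real_derivative F' x) (at x within {a..b})"
    and bd: "\<And>x. x \<in> {a..b} \<Longrightarrow> \<bar>F' x\<bar> \<le> K"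
    and "x \<in> {a..b}" "x' \<in> {a..b}"
  shows "\<bar>F x - F x'\<bar> \<le> K * \<bar>x - x'\<bar>"
  using field_differentiable_bound[of "{a..b}" F F' K x x'] assms by auto

text \<open>\<open>\<theta>\<close> solves the autonomous equation with right-hand side
  \<open>g\<close> and is the inverse of an integral of \<open>1 / g\<close>. It serves twice:
  \<open>g = f\<close> gives the coordinate with ds = dr / f, and \<open>g = exp \<Phi>\<close>
  gives the passage between unnormalised and normalised time.\<close>

lemma reparametrisation:
  fixes g :: "real \<Rightarrow> real"
  assumes ab: "a < b" and cont: "continuous_on {a..b} g" and pos: "\<And>x. x \<in> {a..b} \<Longrightarrow> 0 < g x"
  obtains S \<theta> where "0 < S" "\<theta> 0 = a" "\<theta> S = b" "\<And>\<tau>. \<tau> \<in> {0..S} \<Longrightarrow> \<theta> \<tau> \<in> {a..b}"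
    "\<And>x. x \<in> {a..b} \<Longrightarrow> \<exists>\<tau>\<in>{0..S}. \<theta> \<tau> = x"
    "\<And>\<tau>. \<tau> \<in> {0..S} \<Longrightarrow> (\<theta> has_real_derivative g (\<theta> \<tau>)) (at \<tau> within {0..S})"
proof -
  define G where "G x = integral {a..x} (\<lambda>s. 1 / g s)" for x
  have contI: "continuous_on {a..b} (\<lambda>s. 1 / g s)"
    using pos by (intro continuous_intros cont) force
  have dG: "(G has_real_derivative 1 / g x) (at x within {a..b})" if "x \<in> {a..b}" for x
    unfolding G_def by (rule integral_has_real_derivative[OF contI that])
  have contG: "continuous_on {a..b} G"
    using dG by (meson DERIV_continuous_on)
  have G0: "G a = 0" by (simp add: G_def)
  have less: "G x < G y" if xy: "x \<in> {a..b}" "y \<in> {a..b}" "x < y" for x y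
  proof -
    obtain \<xi> where \<xi>: "x < \<xi>" "\<xi> < y" "G y - G x = (1 / g \<xi>) * (y - x)"
      using mvt_within[of x y "{a..b}" G "\<lambda>x. 1 / g x"] xy dG by auto
    have "0 < g \<xi>" using pos \<xi> xy by auto
    then have "0 < (1 / g \<xi>) * (y - x)" using xy by simp
    then show ?thesis using \<xi> by linarith
  qed
  have inj: "inj_on G {a..b}"
  proof (rule inj_onI)
    fix x y assume "x \<in> {a..b}" "y \<in> {a..b}" "G x = G y"
    then show "x = y" using less[of x y] less[of y x] by (cases x y rule: linorder_cases) auto
  qed
  define S where "S = G b"
  have Spos: "0 < S" using less[of a b] ab G0 by (auto simp: S_def)
  have im: "G ` {a..b} = {0..S}"
  proof
    have "0 \<le> G x \<and> G x \<le> S" if "x \<in> {a..b}" for x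
      using less[of a x] less[of x b] that ab G0 unfolding S_def by (cases "x = a"; cases "x = b") fastforce+
    then show "G ` {a..b} \<subseteq> {0..S}" by auto
    show "{0..S} \<subseteq> G ` {a..b}"
    proof
      fix t assume "t \<in> {0..S}"
      then obtain x where "x \<ge> a" "x \<le> b" "G x = t"
        using IVT'[of G a t b] contG ab G0 by (auto simp: S_def)
      then show "t \<in> G ` {a..b}" by auto
    qed
  qed
  define \<theta> where "\<theta> = inv_into {a..b} G"
  have \<theta>G: "\<theta> (G x) = x" if "x \<in> {a..b}" for x
    using that inj by (simp add: \<theta>_def)
  have G\<theta>: "G (\<theta> t) = t" "\<theta> t \<in> {a..b}" if "t \<in> {0..S}" for t
    using that unfolding \<theta>_def im[symmetric] by (simp_all only: f_inv_into_f inv_into_into)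
  have cont\<theta>: "continuous_on {0..S} \<theta>"
    using continuous_on_inv[OF contG, of \<theta>] \<theta>G im by auto
  have d\<theta>: "(\<theta> has_real_derivative g (\<theta> t)) (at t within {0..S})" if t: "t \<in> {0..S}" for t
  proof -
    have "((\<lambda>x. (G x - G (\<theta> t)) / (x - \<theta> t)) \<longlongrightarrow> 1 / g (\<theta> t)) (at (\<theta> t) within {a..b})"
      using dG[OF G\<theta>(2)[OF t]] by (simp add: has_field_derivative_iff)
    then have "((\<lambda>x. inverse ((G x - G (\<theta> t)) / (x - \<theta> t))) \<longlongrightarrow> inverse (1 / g (\<theta> t))) (at (\<theta> t) within {a..b})"
      using pos[OF G\<theta>(2)[OF t]] by (intro tendsto_inverse) auto
    then have lim: "((\<lambda>x. (x - \<theta> t) / (G x - G (\<theta> t))) \<longlongrightarrow> g (\<theta> t)) (at (\<theta> t) within {a..b})"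
      by simp
    \<comment> \<open>Substituting \<open>\<theta>\<close> into the inverted difference quotient
      requires that it takes the value \<open>\<theta> t\<close> only at \<open>t\<close>.\<close>
    have "filterlim \<theta> (at (\<theta> t) within {a..b}) (at t within {0..S})"
      unfolding filterlim_at
    proof
      show "\<forall>\<^sub>F x in at t within {0..S}. \<theta> x \<in> {a..b} \<and> \<theta> x \<noteq> \<theta> t"
        unfolding eventually_at_filter using G\<theta> t by (intro always_eventually) metis
      show "(\<theta> \<longlongrightarrow> \<theta> t) (at t within {0..S})"
        using cont\<theta> t by (auto simp: continuous_on_def)
    qed
    from filterlim_compose[OF lim this]
    have "((\<lambda>x. (\<theta> x - \<theta> t) / (G (\<theta> x) - G (\<theta> t))) \<longlongrightarrow> g (\<theta> t)) (at t within {0..S})" .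
    then have "((\<lambda>x. (\<theta> x - \<theta> t) / (x - t)) \<longlongrightarrow> g (\<theta> t)) (at t within {0..S})"
      by (rule Lim_transform_eventually)
        (use G\<theta> t in \<open>auto simp: eventually_at_filter intro!: always_eventually\<close>)
    then show ?thesis by (simp add: has_field_derivative_iff)
  qed
  show thesis
  proof (rule that[OF Spos])
    show "\<theta> 0 = a" using \<theta>G[of a] G0 ab by auto
    show "\<theta> S = b" using \<theta>G[of b] ab by (auto simp: S_def)
    show "\<exists>\<tau>\<in>{0..S}. \<theta> \<tau> = x" if "x \<in> {a..b}" for x
      using that \<theta>G im by blast
  qed (use G\<theta> d\<theta> in auto)
qed

text \<open>At an end the maximum gives one sign of \<open>G x\<close> and \<open>b0\<close> or
  \<open>bL\<close> the other, so \<open>G x = 0\<close> as in the interior. If then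
  \<open>H > 0\<close>, \<open>G\<close> is positive just to the right of \<open>x\<close> (at
  \<open>L\<close>: negative just to the left), and the mean value theorem yields a larger value of
  \<open>Q\<close>.\<close>

lemma second_derivative_test_Neumann:
  fixes Q G :: "real \<Rightarrow> real"
  assumes L: "0 < L" and x: "x \<in> {0..L}"
    and dQ: "\<And>\<xi>. \<xi> \<in> {0..L} \<Longrightarrow> (Q has_real_derivative G \<xi>) (at \<xi> within {0..L})"
    and dG: "(G has_real_derivative H) (at x within {0..L})"
    and max: "\<And>\<xi>. \<xi> \<in> {0..L} \<Longrightarrow> Q \<xi> \<le> Q x"
    and b0: "x = 0 \<Longrightarrow> 0 \<le> G x" and bL: "x = L \<Longrightarrow> G x \<le> 0"
  shows "G x = 0" "H \<le> 0"
proof -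
  have le: "G x \<le> 0"
  proof (cases "x = L")
    case False
    show ?thesis
    proof (rule ccontr)
      assume "\<not> G x \<le> 0"
      then obtain d where d: "d > 0" "\<forall>h>0. x + h \<in> {0..L} \<longrightarrow> h < d \<longrightarrow> Q x < Q (x + h)"
        using has_real_derivative_pos_inc_right[OF dQ[OF x]] by auto
      define h where "h = min (d/2) (L - x)"
      have "0 < h" "h < d" "x + h \<in> {0..L}" using d(1) x False by (auto simp: h_def)
      then show False using d(2) max[of "x + h"] by force
    qed
  qed (use bL in simp)
  have ge: "0 \<le> G x"
  proof (cases "x = 0")
    case False
    show ?thesis
    proof (rule ccontr)
      assume "\<not> 0 \<le> G x"
      then obtain d where d: "d > 0" "\<forall>h>0. x - h \<in> {0..L} \<longrightarrow> h < d \<longrightarrow> Q x < Q (x - h)"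
        using has_real_derivative_neg_dec_left[OF dQ[OF x]] by auto
      define h where "h = min (d/2) x"
      have "0 < h" "h < d" "x - h \<in> {0..L}" using d(1) x False by (auto simp: h_def)
      then show False using d(2) max[of "x - h"] by force
    qed
  qed (use b0 in simp)
  show G0: "G x = 0" using le ge by simp
  show "H \<le> 0"
  proof (rule ccontr)
    assume "\<not> H \<le> 0"
    then have H: "0 < H" by simp
    show False
    proof (cases "x < L")
      case True
      obtain d where d: "d > 0" "\<forall>h>0. x + h \<in> {0..L} \<longrightarrow> h < d \<longrightarrow> G x < G (x + h)"
        using has_real_derivative_pos_inc_right[OF dG H] by auto
      define h where "h = min (d/2) (L - x)"
      have h: "0 < h" "h < d" "x + h \<in> {0..L}" using d(1) x True by (auto simp: h_def)
      obtain \<xi> where \<xi>: "x < \<xi>" "\<xi> < x + h" "Q (x + h) - Q x = G \<xi> * (x + h - x)"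
        using mvt_within[of x "x + h" "{0..L}" Q G] h x dQ by auto
      have "0 < G \<xi>" using d(2)[rule_format, of "\<xi> - x"] \<xi> h x G0 by auto
      then have "0 < G \<xi> * (x + h - x)" using h by simp
      then show False using \<xi> max[OF h(3)] by linarith
    next
      case False
      then have xL: "x = L" using x by auto
      obtain d where d: "d > 0" "\<forall>h>0. x - h \<in> {0..L} \<longrightarrow> h < d \<longrightarrow> G (x - h) < G x"
        using has_real_derivative_pos_inc_left[OF dG H] by auto
      define h where "h = min (d/2) L"
      have h: "0 < h" "h < d" "x - h \<in> {0..L}" using d(1) x xL L by (auto simp: h_def)
      obtain \<xi> where \<xi>: "x - h < \<xi>" "\<xi> < x" "Q x - Q (x - h) = G \<xi> * (x - (x - h))"
        using mvt_within[of "x - h" x "{0..L}" Q G] h x dQ by auto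
      have "G \<xi> < 0" using d(2)[rule_format, of "x - \<xi>"] \<xi> h x G0 by auto
      then have "G \<xi> * (x - (x - h)) < 0" using h by (simp add: mult_neg_pos)
      then show False using \<xi> max[OF h(3)] by linarith
    qed
  qed
qed

text \<open>Because \<open>0 < t\<close> one can look back in time, so the test also covers a
  maximum at the final time.\<close>

lemma derivative_nonneg_at_max:
  fixes Q :: "real \<Rightarrow> real"
  assumes "0 < t" "t \<in> {0..t0}" "(Q has_real_derivative d) (at t within {0..t0})"
    and max: "\<And>\<tau>. \<tau> \<in> {0..t0} \<Longrightarrow> Q \<tau> \<le> Q t"
  shows "0 \<le> d"
proof (rule ccontr)
  assume "\<not> 0 \<le> d"
  then obtain e where e: "e > 0" "\<forall>h>0. t - h \<in> {0..t0} \<longrightarrow> h < e \<longrightarrow> Q t < Q (t - h)"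
    using has_real_derivative_neg_dec_left[OF assms(3)] by auto
  define h where "h = min (e/2) t"
  have "0 < h" "h < e" "t - h \<in> {0..t0}" using e(1) assms by (auto simp: h_def)
  then show False using e(2) max[of "t - h"] by force
qed

text \<open>Transfers a maximum principle for functions averaged over time \<open>h\<close> to the limit \<open>h \<rightarrow> 0\<close>.\<close>
lemma maximum_points_converge:
  fixes F :: "'a::metric_space \<Rightarrow> real \<Rightarrow> real"
  assumes K: "compact K" "K \<noteq> {}" and h0: "0 < h0"
    and cont: "continuous_on (K \<times> {0..h0}) (\<lambda>(k, h). F k h)"
  obtains h p p' where "\<And>n. 0 < h n" "\<And>n::nat. h n \<le> h0" "h \<longlonglongrightarrow> 0"
    "\<And>n. p n \<in> K" "\<And>n k. k \<in> K \<Longrightarrow> F k (h n) \<le> F (p n) (h n)"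
    "p \<longlonglongrightarrow> p'" "p' \<in> K" "\<And>k. k \<in> K \<Longrightarrow> F k 0 \<le> F p' 0"
proof -
  define h where "h n = h0 / real (Suc n)" for n
  have hpos: "0 < h n" "h n \<le> h0" for n using h0 by (auto simp: h_def field_simps)
  have hlim: "h \<longlonglongrightarrow> 0"
    using LIMSEQ_Suc[OF lim_const_over_n[of h0]] by (simp add: h_def[abs_def])
  have "\<exists>p\<in>K. \<forall>k\<in>K. F k (h n) \<le> F p (h n)" for n
  proof -
    have "continuous_on K (\<lambda>k. F k (h n))"
      by (rule continuous_on_compose2[OF cont, of K "\<lambda>k. (k, h n)", simplified])
        (use hpos[of n] in \<open>auto intro!: continuous_intros\<close>)
    then show ?thesis using continuous_attains_sup[OF K] by auto
  qed
  then obtain p where p: "\<And>n. p n \<in> K" "\<And>n k. k \<in> K \<Longrightarrow> F k (h n) \<le> F (p n) (h n)"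
    by metis
  \<comment> \<open>A subsequence of the maximum points converges, and joint continuity up to
    \<open>h = 0\<close> makes its limit a maximum point there.\<close>
  obtain p' r where r: "p' \<in> K" "strict_mono r" "(p \<circ> r) \<longlonglongrightarrow> p'"
    using K(1) p(1) unfolding compact_def by meson
  have hr: "(h \<circ> r) \<longlonglongrightarrow> 0" by (rule LIMSEQ_subseq_LIMSEQ[OF hlim r(2)])
  have lim: "(\<lambda>n. F (q n) ((h \<circ> r) n)) \<longlonglongrightarrow> F q' 0"
    if "q \<longlonglongrightarrow> q'" "\<And>n. q n \<in> K" "q' \<in> K" for q q'
  proof -
    have "(\<lambda>n. (q n, (h \<circ> r) n)) \<longlonglongrightarrow> (q', 0)" using that hr by (intro tendsto_intros)
    from continuous_on_tendsto_compose[OF cont this]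
    show ?thesis using that hpos h0 by (auto simp: less_imp_le)
  qed
  show thesis
  proof (rule that[of "h \<circ> r" "p \<circ> r" p'])
    fix k assume k: "k \<in> K"
    have "(\<lambda>n. F k ((h \<circ> r) n)) \<longlonglongrightarrow> F k 0" using lim[of "\<lambda>_. k" k] k by simp
    moreover have "(\<lambda>n. F ((p \<circ> r) n) ((h \<circ> r) n)) \<longlonglongrightarrow> F p' 0"
      by (rule lim[OF r(3)]) (use r(1) p in auto)
    ultimately show "F k 0 \<le> F p' 0"
      by (rule LIMSEQ_le) (use p k in auto)
  next
    show "(p \<circ> r) \<longlonglongrightarrow> p'" by (rule r(3))
  qed (use p r(1) hr hpos in auto)
qed

section \<open>Averages in time\<close>

text \<open>Steklov average over \<open>[t, t + h]\<close>, rescaled to \<open>[0, 1]\<close> so that it is jointly continuous in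
  \<open>(x, t, h)\<close> up to \<open>h = 0\<close>, where it equals \<open>F\<close>.\<close>
definition avg :: "('a \<Rightarrow> real \<Rightarrow> real) \<Rightarrow> 'a \<Rightarrow> real \<Rightarrow> real \<Rightarrow> real" where
  "avg F x t h = integral {0..1} (\<lambda>\<sigma>. F x (t + h * \<sigma>))"

lemma avg_0 [simp]: "avg F x t 0 = F x t"
  by (simp add: avg_def)

lemma shift_in_interval:
  fixes t h \<sigma> S :: real
  assumes "0 \<le> t" "0 \<le> h" "t + h \<le> S" "0 \<le> \<sigma>" "\<sigma> \<le> 1"
  shows "0 \<le> t + h * \<sigma>" "t + h * \<sigma> \<le> S"
proof -
  have "h * \<sigma> \<le> h * 1" using assms by (intro mult_left_mono) auto
  then show "t + h * \<sigma> \<le> S" using assms by simp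
qed (use assms in simp)

lemma continuous_on_avg:
  fixes F :: "'a::topological_space \<Rightarrow> real \<Rightarrow> real"
  assumes cont: "continuous_on (X \<times> {0..S}) (\<lambda>(x, t). F x t)"
  shows "continuous_on ((X \<times> {0..t0}) \<times> {0..S - t0}) (\<lambda>((x, t), h). avg F x t h)"
proof -
  have "continuous_on (((X \<times> {0..t0}) \<times> {0..S - t0}) \<times> cbox 0 1)
      (\<lambda>(p, \<sigma>). (\<lambda>((x, t), h) \<sigma>. F x (t + h * \<sigma>)) p (\<sigma>::real))"
    unfolding split_def
  proof (rule continuous_on_compose2[OF cont, 
        of _ "\<lambda>w. (fst (fst (fst w)), snd (fst (fst w)) + snd (fst w) * snd w)", simplified split_def fst_conv snd_conv])
    show "(\<lambda>w. (fst (fst (fst w)), snd (fst (fst w)) + snd (fst w) * snd w)) `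
        (((X \<times> {0..t0}) \<times> {0..S - t0}) \<times> cbox 0 1) \<subseteq> X \<times> {0..S}"
      using shift_in_interval by (fastforce simp: cbox_interval)
  qed (intro continuous_intros)
  from integral_continuous_on_param[OF this]
  show ?thesis by (simp add: avg_def split_def cbox_interval)
qed

lemma avg_has_derivative_space:
  fixes F F' :: "real \<Rightarrow> real \<Rightarrow> real"
  assumes der: "\<And>x t. x \<in> X \<Longrightarrow> t \<in> {0..S} \<Longrightarrow>
      ((\<lambda>x. F x t) has_real_derivative F' x t) (at x within X)"
    and cont: "continuous_on (X \<times> {0..S}) (\<lambda>(x, t). F x t)"
    and cont': "continuous_on (X \<times> {0..S}) (\<lambda>(x, t). F' x t)"
    and X: "convex X" "x \<in> X" and t: "0 \<le> t" "0 \<le> h" "t + h \<le> S"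
  shows "((\<lambda>x. avg F x t h) has_real_derivative avg F' x t h) (at x within X)"
  unfolding avg_def cbox_interval[symmetric]
proof (rule leibniz_rule_field_derivative[OF _ _ _ X(2,1)])
  have sh: "0 \<le> t + h * \<sigma>" "t + h * \<sigma> \<le> S" if "\<sigma> \<in> cbox 0 1" for \<sigma>
    using shift_in_interval[OF t] that by (auto simp: cbox_interval)
  show "((\<lambda>x. F x (t + h * \<sigma>)) has_field_derivative F' x (t + h * \<sigma>)) (at x within X)"
    if "x \<in> X" "\<sigma> \<in> cbox 0 1" for x \<sigma>
    using der[OF that(1)] sh[OF that(2)] by auto
  show "(\<lambda>\<sigma>. F x (t + h * \<sigma>)) integrable_on cbox 0 1" if "x \<in> X" for x
  proof (rule integrable_continuous)
    show "continuous_on (cbox 0 1) (\<lambda>\<sigma>. F x (t + h * \<sigma>))"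
      by (rule continuous_on_compose2[OF cont, of _ "\<lambda>\<sigma>. (x, t + h * \<sigma>)", unfolded split_conv])
        (use sh that in \<open>auto intro!: continuous_intros\<close>)
  qed
  show "continuous_on (X \<times> cbox 0 1) (\<lambda>(x, \<sigma>). F' x (t + h * \<sigma>))"
    using continuous_on_compose2[OF cont', of "X \<times> cbox 0 1" "\<lambda>w. (fst w, t + h * snd w)"] sh
    by (fastforce intro!: continuous_intros simp: split_def)
qed

text \<open>The average of a time derivative is a difference quotient of \<open>F\<close>, so it
  inherits the space regularity of \<open>F\<close>, which may exceed that of
  \<open>F'\<close>.\<close>

lemma avg_eq_difference_quotient:
  fixes F F' :: "'a \<Rightarrow> real \<Rightarrow> real"
  assumes der: "\<And>t. t \<in> {0..S} \<Longrightarrow> (F x has_real_derivative F' x t) (at t within {0..S})"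
    and t: "0 \<le> t" "0 < h" "t + h \<le> S"
  shows "avg F' x t h = (F x (t + h) - F x t) / h"
proof -
  have "((\<lambda>\<sigma>. F' x (t + h * \<sigma>)) has_integral F x (t + h * 1) / h - F x (t + h * 0) / h) {0..1}"
  proof (rule fundamental_theorem_of_calculus)
    fix \<sigma> :: real assume \<sigma>: "\<sigma> \<in> {0..1}"
    have sub: "(\<lambda>\<sigma>. t + h * \<sigma>) ` {0..1} \<subseteq> {0..S}"
      using shift_in_interval[of t h S] t by auto
    have "(F x has_real_derivative F' x (t + h * \<sigma>)) (at (t + h * \<sigma>) within (\<lambda>\<sigma>. t + h * \<sigma>) ` {0..1})"
      by (rule DERIV_subset[OF der sub]) (use sub \<sigma> in blast)
    moreover have "((\<lambda>\<sigma>. t + h * \<sigma>) has_real_derivative h) (at \<sigma> within {0..1})"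
      by (auto intro!: derivative_eq_intros)
    ultimately have "((\<lambda>\<sigma>. F x (t + h * \<sigma>)) has_real_derivative F' x (t + h * \<sigma>) * h) (at \<sigma> within {0..1})"
      by (rule DERIV_image_chain[unfolded o_def])
    then have "((\<lambda>\<sigma>. F x (t + h * \<sigma>) / h) has_real_derivative F' x (t + h * \<sigma>) * h / h) (at \<sigma> within {0..1})"
      by (rule DERIV_cdivide)
    then show "((\<lambda>\<sigma>. F x (t + h * \<sigma>) / h) has_vector_derivative F' x (t + h * \<sigma>)) (at \<sigma> within {0..1})"
      using t by (simp add: has_real_derivative_iff_has_vector_derivative)
  qed simp
  then show ?thesis using t
    by (simp add: avg_def integral_unique diff_divide_distrib)
qed

lemma has_derivative_time_shift:
  fixes \<Phi> :: "real \<Rightarrow> real"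
  assumes "(\<Phi> has_real_derivative D) (at (t + h) within {0..S})" "0 \<le> h" "t0 + h \<le> S" "t \<in> {0..t0}"
  shows "((\<lambda>t. \<Phi> (t + h)) has_real_derivative D) (at t within {0..t0})"
proof -
  have "(\<Phi> has_real_derivative D) (at (t + h) within (\<lambda>t. t + h) ` {0..t0})"
    using assms by (intro DERIV_subset[OF assms(1)]) auto
  moreover have "((\<lambda>t. t + h) has_real_derivative 1) (at t within {0..t0})"
    by (auto intro!: derivative_eq_intros)
  ultimately show ?thesis
    using DERIV_image_chain[of \<Phi> D "\<lambda>t. t + h" t "{0..t0}" 1] by (simp add: o_def)
qed

text \<open>Averaging makes a merely continuous function differentiable in time, since the average
  is a difference quotient of an antiderivative.\<close>

lemma avg_has_derivative_time:
  fixes F :: "'a \<Rightarrow> real \<Rightarrow> real"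
  assumes cont: "continuous_on {0..S} (F x)"
    and t: "t \<in> {0..t0}" "0 < h" "t0 + h \<le> S"
  shows "((\<lambda>t. avg F x t h) has_real_derivative (F x (t + h) - F x t) / h) (at t within {0..t0})"
proof -
  define \<Phi> where "\<Phi> x \<tau> = integral {0..\<tau>} (F x)" for x \<tau>
  have d: "(\<Phi> x has_real_derivative F x \<tau>) (at \<tau> within {0..S})" if "\<tau> \<in> {0..S}" for \<tau>
    unfolding \<Phi>_def by (rule integral_has_real_derivative[OF cont that])
  have eq: "avg F x \<tau> h = (\<Phi> x (\<tau> + h) - \<Phi> x \<tau>) / h" if "\<tau> \<in> {0..t0}" for \<tau>
    using avg_eq_difference_quotient[of S \<Phi> x F, OF d] that t by auto
  have "((\<lambda>\<tau>. (\<Phi> x (\<tau> + h) - \<Phi> x \<tau>) / h) has_real_derivative (F x (t + h) - F x t) / h)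
      (at t within {0..t0})"
    using t d[of t] d[of "t + h"]
    by (intro DERIV_cdivide DERIV_diff has_derivative_time_shift) (auto intro: DERIV_subset)
  then show ?thesis
    by (rule has_field_derivative_transform_within[where d = 1]) (use t eq in auto)
qed

section \<open>Logarithmic diffusion on an interval\<close>

text \<open>The penalty \<open>\<epsilon> * t\<close> makes the inequality in a maximum principle
  strict; the slope is small enough to keep an excess \<open>g\<close> at time \<open>t\<close>
  positive.\<close>

lemma small_slope:
  fixes g t :: real
  assumes "0 < g" "0 \<le> t"
  obtains \<epsilon> where "0 < \<epsilon>" "\<epsilon> * t < g"
proof (rule that[of "g / (t + 1)"])
  have "g * t < g * (t + 1)" using assms by (simp add: algebra_simps)
  then show "g / (t + 1) * t < g" using assms by (simp add: pos_divide_less_eq)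
qed (use assms in simp)

text \<open>\<open>exp z (dx\<^sup>2 + d\<theta>\<^sup>2)\<close> moves by the unnormalised flow \<open>z\<^sub>t = exp (-z) z\<^sub>x\<^sub>x\<close>; \<open>y\<close> and \<open>w\<close> are
  \<open>z\<^sub>x\<close> and \<open>z\<^sub>x\<^sub>x\<close>, the scalar curvature is \<open>- w / exp z\<close>, and the boundary conditions say that the boundary
  circles keep the geodesic curvatures \<open>- c0 / 2\<close> and \<open>cL / 2\<close>.\<close>
locale log_diffusion =
  fixes L S c0 cL :: real and z y w :: "real \<Rightarrow> real \<Rightarrow> real"
  assumes L: "0 < L" and c0: "0 \<le> c0" and cL: "cL \<le> 0"
    and z_x: "\<And>x t. x \<in> {0..L} \<Longrightarrow> t \<in> {0..S} \<Longrightarrow>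
      ((\<lambda>x. z x t) has_real_derivative y x t) (at x within {0..L})"
    and y_x: "\<And>x t. x \<in> {0..L} \<Longrightarrow> t \<in> {0..S} \<Longrightarrow>
      ((\<lambda>x. y x t) has_real_derivative w x t) (at x within {0..L})"
    and z_t: "\<And>x t. x \<in> {0..L} \<Longrightarrow> t \<in> {0..S} \<Longrightarrow>
      (z x has_real_derivative w x t / exp (z x t)) (at t within {0..S})"
    and cont: "continuous_on ({0..L} \<times> {0..S}) (\<lambda>(x, t). z x t)"
      "continuous_on ({0..L} \<times> {0..S}) (\<lambda>(x, t). y x t)"
      "continuous_on ({0..L} \<times> {0..S}) (\<lambda>(x, t). w x t)"
    and bc0: "\<And>t. t \<in> {0..S} \<Longrightarrow> y 0 t = c0 * exp (z 0 t / 2)"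
    and bcL: "\<And>t. t \<in> {0..S} \<Longrightarrow> y L t = cL * exp (z L t / 2)"
begin

text \<open>\<open>z\<close> is regular enough for the classical maximum principle: at a maximum of
  \<open>z - \<epsilon> * t\<close> with positive time the equation forces \<open>w > 0\<close>, the
  second derivative test \<open>w \<le> 0\<close>. The signs of \<open>c0\<close> and
  \<open>cL\<close> are those that the test asks for at the ends.\<close>

lemma le_initial:
  assumes M: "\<And>x. x \<in> {0..L} \<Longrightarrow> z x 0 \<le> M" and x1: "x1 \<in> {0..L}" and t1: "t1 \<in> {0..S}"
  shows "z x1 t1 \<le> M"
proof (rule ccontr)
  assume "\<not> z x1 t1 \<le> M"
  then have gt: "0 < z x1 t1 - M" by simp
  obtain \<epsilon> where \<epsilon>: "0 < \<epsilon>" "\<epsilon> * t1 < z x1 t1 - M"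
    by (rule small_slope[OF gt, of t1]) (use t1 in simp)
  then have \<epsilon>1: "M < z x1 t1 - \<epsilon> * t1" by linarith
  have ne: "{0..L} \<times> {0..S} \<noteq> {}" using x1 t1 by auto
  have "continuous_on ({0..L} \<times> {0..S}) (\<lambda>p. z (fst p) (snd p) - \<epsilon> * snd p)"
    using cont(1) by (intro continuous_intros) (simp add: split_def)
  from continuous_attains_sup[OF compact_Times[OF compact_Icc compact_Icc] ne this]
  obtain q where q: "q \<in> {0..L} \<times> {0..S}"
      "\<forall>k\<in>{0..L} \<times> {0..S}. z (fst k) (snd k) - \<epsilon> * snd k \<le> z (fst q) (snd q) - \<epsilon> * snd q"
    by (rule bexE)
  obtain x t where xt: "q = (x, t)" "x \<in> {0..L}" "t \<in> {0..S}" using q(1) by auto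
  have max: "z \<xi> \<tau> - \<epsilon> * \<tau> \<le> z x t - \<epsilon> * t" if "\<xi> \<in> {0..L}" "\<tau> \<in> {0..S}" for \<xi> \<tau>
    using bspec[OF q(2), of "(\<xi>, \<tau>)"] that xt by simp
  have tpos: "0 < t"
  proof (rule ccontr)
    assume "\<not> 0 < t"
    then have "t = 0" using xt by auto
    then show False using max[OF x1 t1] M[OF xt(2)] \<epsilon>1 by simp
  qed
  have "0 \<le> w x t / exp (z x t) - \<epsilon>"
    by (rule derivative_nonneg_at_max[OF tpos xt(3), where Q = "\<lambda>t. z x t - \<epsilon> * t"])
      (use max xt in \<open>auto intro!: derivative_eq_intros z_t\<close>)
  then have "0 < w x t / exp (z x t)" using \<epsilon>(1) by linarith
  then have "0 < w x t" by (simp add: zero_less_divide_iff)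
  moreover have "w x t \<le> 0"
  proof (rule second_derivative_test_Neumann(2)[OF L xt(2) z_x[OF _ xt(3)] y_x[OF xt(2,3)]])
    show "z \<xi> t \<le> z x t" if "\<xi> \<in> {0..L}" for \<xi> using max[OF that xt(3)] by simp
    show "x = 0 \<Longrightarrow> 0 \<le> y x t" using bc0 xt c0 by simp
    show "x = L \<Longrightarrow> y x t \<le> 0" using bcL xt cL by (simp add: mult_nonpos_nonneg)
  qed
  ultimately show False by simp
qed

text \<open>\<open>v\<close> is the conformal factor and \<open>p\<close> the time derivative of
  \<open>z\<close>, that is, minus the scalar curvature. \<open>E\<close> is the square root of
  \<open>v\<close> from the boundary conditions; \<open>E'\<close>, \<open>E''\<close> and
  \<open>Et\<close> are its space and time derivatives.\<close>

definition "v x t = exp (z x t)"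
definition "E x t = exp (z x t / 2)"
definition "p x t = w x t / v x t"
definition "E' x t = E x t * y x t / 2"
definition "E'' x t = E x t * ((y x t)\<^sup>2 / 2 + w x t) / 2"
definition "Et x t = E x t * p x t / 2"

lemma v_pos: "0 < v x t" and E_pos: "0 < E x t" and E_sq: "(E x t)\<^sup>2 = v x t"
  by (auto simp: v_def E_def power2_eq_square simp flip: exp_add)

lemma w_eq: "w x t = v x t * p x t"
  using v_pos[of x t] by (simp add: p_def)

lemma v_x: "x \<in> {0..L} \<Longrightarrow> t \<in> {0..S} \<Longrightarrow>
    ((\<lambda>x. v x t) has_real_derivative v x t * y x t) (at x within {0..L})"
  unfolding v_def by (rule derivative_eq_intros z_x | simp)+

lemma v_t: "x \<in> {0..L} \<Longrightarrow> t \<in> {0..S} \<Longrightarrow> (v x has_real_derivative w x t) (at t within {0..S})"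
  unfolding v_def by (rule derivative_eq_intros z_t | simp)+

lemma E_x: "x \<in> {0..L} \<Longrightarrow> t \<in> {0..S} \<Longrightarrow>
    ((\<lambda>x. E x t) has_real_derivative E' x t) (at x within {0..L})"
  using DERIV_chain2[OF DERIV_exp DERIV_cdivide[OF z_x, of _ _ 2]] by (simp add: E_def E'_def)

lemma E'_x: "x \<in> {0..L} \<Longrightarrow> t \<in> {0..S} \<Longrightarrow>
    ((\<lambda>x. E' x t) has_real_derivative E'' x t) (at x within {0..L})"
  unfolding E'_def E''_def
  by (rule derivative_eq_intros E_x y_x | simp add: E'_def power2_eq_square algebra_simps)+

lemma E_t: "x \<in> {0..L} \<Longrightarrow> t \<in> {0..S} \<Longrightarrow>
    (E x has_real_derivative Et x t) (at t within {0..S})"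
  unfolding E_def Et_def p_def v_def by (rule derivative_eq_intros z_t | simp)+

lemma p_t: "x \<in> {0..L} \<Longrightarrow> t \<in> {0..S} \<Longrightarrow> (z x has_real_derivative p x t) (at t within {0..S})"
  using z_t by (simp add: p_def v_def)

lemma cont':
  "continuous_on ({0..L} \<times> {0..S}) (\<lambda>(x, t). v x t)"
  "continuous_on ({0..L} \<times> {0..S}) (\<lambda>(x, t). E x t)"
  "continuous_on ({0..L} \<times> {0..S}) (\<lambda>(x, t). p x t)"
  "continuous_on ({0..L} \<times> {0..S}) (\<lambda>(x, t). E' x t)"
  "continuous_on ({0..L} \<times> {0..S}) (\<lambda>(x, t). E'' x t)"
  "continuous_on ({0..L} \<times> {0..S}) (\<lambda>(x, t). Et x t)"
  using cont unfolding v_def E_def p_def E'_def E''_def Et_def split_def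
  by (auto intro!: continuous_intros)

lemma cont_time:
  assumes "continuous_on ({0..L} \<times> {0..S}) (\<lambda>(x, t). F x t)" "x \<in> {0..L}"
  shows "continuous_on {0..S} (F x)"
  by (rule continuous_on_compose2[OF assms(1), of _ "\<lambda>t. (x, t)", unfolded split_conv])
    (use assms in \<open>auto intro!: continuous_intros\<close>)

text \<open>Since \<open>w\<close> is the time derivative of \<open>v\<close>, its average is a
  difference quotient of \<open>v\<close> and hence differentiable in \<open>x\<close>. So the
  average of \<open>y\<close> has two space derivatives, although \<open>y\<close> is assumed to
  have only one.\<close>

lemma avg_y_x:
  assumes "x \<in> {0..L}" "0 \<le> t" "0 < h" "t + h \<le> S"
  shows "((\<lambda>x. avg y x t h) has_real_derivative (v x (t + h) - v x t) / h) (at x within {0..L})"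
    and "((\<lambda>x. (v x (t + h) - v x t) / h) has_real_derivative
          (v x (t + h) * y x (t + h) - v x t * y x t) / h) (at x within {0..L})"
proof -
  have "((\<lambda>x. avg y x t h) has_real_derivative avg w x t h) (at x within {0..L})"
    by (rule avg_has_derivative_space[OF _ cont(2,3)]) (use assms y_x in auto)
  then show "((\<lambda>x. avg y x t h) has_real_derivative (v x (t + h) - v x t) / h) (at x within {0..L})"
    using avg_eq_difference_quotient[of S v x w, OF v_t] assms by simp
qed (use assms v_x in \<open>auto intro!: derivative_eq_intros\<close>)

text \<open>The average of \<open>y\<close> satisfies \<open>y\<^sub>t = (y\<^sub>x\<^sub>x - y y\<^sub>x) / v\<close> exactly, with \<open>v\<close> taken at \<open>t + h\<close> and the
  factor \<open>y\<close> at \<open>t\<close>, so its maximum lies on the parabolic boundary.\<close>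
lemma space_derivative_le:
  assumes x1: "x1 \<in> {0..L}" and t1: "0 \<le> t1" "t1 < S"
    and par: "\<And>x. x \<in> {0..L} \<Longrightarrow> s * y x 0 \<le> Y"
      "\<And>t. t \<in> {0..S} \<Longrightarrow> s * y 0 t \<le> Y" "\<And>t. t \<in> {0..S} \<Longrightarrow> s * y L t \<le> Y"
  shows "s * y x1 t1 \<le> Y"
proof (rule ccontr)
  assume "\<not> s * y x1 t1 \<le> Y"
  then have gt: "0 < s * y x1 t1 - Y" by simp
  obtain \<epsilon> where \<epsilon>: "0 < \<epsilon>" "\<epsilon> * t1 < s * y x1 t1 - Y"
    by (rule small_slope[OF gt t1(1)])
  then have \<epsilon>1: "Y < s * y x1 t1 - \<epsilon> * t1" by linarith
  \<comment> \<open>Stopping at \<open>t1 < S\<close> leaves room for the averaging window.\<close>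
  define K where "K = {0..L} \<times> {0..t1}"
  have K: "compact K" "(x1, t1) \<in> K" using x1 t1 by (auto simp: K_def compact_Times)
  have "continuous_on (K \<times> {0..S - t1}) (\<lambda>(q, h). s * avg y (fst q) (snd q) h - \<epsilon> * snd q)"
    using continuous_on_avg[OF cont(2), of t1] unfolding K_def split_def
    by (intro continuous_intros) auto
  then obtain hs ps q' where hs: "\<And>n. 0 < hs n" "\<And>n::nat. hs n \<le> S - t1" "hs \<longlonglongrightarrow> 0"
    and ps: "\<And>n. ps n \<in> K" "\<And>n k. k \<in> K \<Longrightarrow> s * avg y (fst k) (snd k) (hs n) - \<epsilon> * snd k
        \<le> s * avg y (fst (ps n)) (snd (ps n)) (hs n) - \<epsilon> * snd (ps n)"
      "ps \<longlonglongrightarrow> q'"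
    and q': "q' \<in> K" "\<And>k. k \<in> K \<Longrightarrow> s * avg y (fst k) (snd k) 0 - \<epsilon> * snd k
        \<le> s * avg y (fst q') (snd q') 0 - \<epsilon> * snd q'"
    using maximum_points_converge[OF K(1), of "S - t1" "\<lambda>q h. s * avg y (fst q) (snd q) h - \<epsilon> * snd q"] K(2) t1
    by (smt (verit, best) empty_iff)
  obtain x' t' where xt': "q' = (x', t')" "x' \<in> {0..L}" "t' \<in> {0..t1}"
    using q'(1) by (auto simp: K_def)
  have gt': "Y < s * y x' t' - \<epsilon> * t'" using q'(2)[OF K(2)] \<epsilon>1 xt' by simp
  \<comment> \<open>The limit point lies off the parabolic boundary, where \<open>par\<close>
    applies; so for small \<open>h\<close> the maximum points of the averages are interior
    too.\<close>
  have "0 \<le> \<epsilon> * t'" using \<epsilon>(1) xt' by simp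
  then have "0 < t'" "0 < x'" "x' < L"
    using gt' par(1)[of x'] par(2,3)[of t'] xt' t1 by (auto simp: less_le)
  moreover have "(\<lambda>n. fst (ps n)) \<longlonglongrightarrow> x'" "(\<lambda>n. snd (ps n)) \<longlonglongrightarrow> t'"
    using tendsto_fst[OF ps(3)] tendsto_snd[OF ps(3)] xt' by auto
  ultimately have "\<forall>\<^sub>F n in sequentially. 0 < snd (ps n) \<and> 0 < fst (ps n) \<and> fst (ps n) < L"
    by (intro eventually_conj order_tendstoD)
  then obtain n where n: "0 < snd (ps n)" "0 < fst (ps n)" "fst (ps n) < L"
    by (auto simp: eventually_sequentially)
  define h where "h = hs n"
  define x where "x = fst (ps n)"
  define t where "t = snd (ps n)"
  have x: "x \<in> {0..L}" "0 < x" "x < L" and t: "0 < t" "t \<in> {0..t1}" and h: "0 < h" "t1 + h \<le> S"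
    using n ps(1)[of n] hs(1,2)[of n] by (auto simp: K_def x_def t_def h_def)
  have max: "s * avg y \<xi> \<tau> h - \<epsilon> * \<tau> \<le> s * avg y x t h - \<epsilon> * t"
    if "\<xi> \<in> {0..L}" "\<tau> \<in> {0..t1}" for \<xi> \<tau>
    using ps(2)[of "(\<xi>, \<tau>)" n] that by (auto simp: K_def x_def t_def h_def)
  have dy: "((\<lambda>t. avg y x t h) has_real_derivative (y x (t + h) - y x t) / h) (at t within {0..t1})"
    by (rule avg_has_derivative_time[where F = y and x = x, OF cont_time[OF cont(2) x(1)] t(2) h])
  have dt: "0 \<le> s * ((y x (t + h) - y x t) / h) - \<epsilon>"
    by (rule derivative_nonneg_at_max[OF t, where Q = "\<lambda>t. s * avg y x t h - \<epsilon> * t"])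
      (use max x DERIV_diff[OF DERIV_cmult[OF dy] DERIV_cmult_Id] in auto)
  have th: "0 \<le> t" "t + h \<le> S" using t h by auto
  have dx: "((\<lambda>\<xi>. s * avg y \<xi> t h - \<epsilon> * t) has_real_derivative s * ((v \<xi> (t + h) - v \<xi> t) / h))
      (at \<xi> within {0..L})" if "\<xi> \<in> {0..L}" for \<xi>
    using avg_y_x(1)[of \<xi>] that th h by (auto intro!: derivative_eq_intros)
  have dxx: "((\<lambda>\<xi>. s * ((v \<xi> (t + h) - v \<xi> t) / h)) has_real_derivative
      s * ((v x (t + h) * y x (t + h) - v x t * y x t) / h)) (at x within {0..L})"
    using avg_y_x(2)[OF x(1) th(1) h(1) th(2)] by (rule DERIV_cmult)
  have "s * ((v x (t + h) - v x t) / h) = 0" "s * ((v x (t + h) * y x (t + h) - v x t * y x t) / h) \<le> 0"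
    using second_derivative_test_Neumann[OF L x(1) dx dxx max[OF _ t(2)]] x by auto
  then have e: "s * (v x (t + h) - v x t) = 0" "s * (v x (t + h) * y x (t + h) - v x t * y x t) \<le> 0"
    using h by (auto simp: divide_le_0_iff mult_le_0_iff)
  \<comment> \<open>Product rule for differences. The last term vanishes with the first derivative
    at the maximum, so the second derivative has the sign of the time difference of
    \<open>y\<close>.\<close>
  have "s * (v x (t + h) * y x (t + h) - v x t * y x t)
      = v x (t + h) * (s * (y x (t + h) - y x t)) + y x t * (s * (v x (t + h) - v x t))"
    by (simp add: algebra_simps)
  then have "v x (t + h) * (s * (y x (t + h) - y x t)) \<le> 0" using e by (metis add.right_neutral mult_zero_right)
  then have "s * (y x (t + h) - y x t) \<le> 0" using v_pos[of x "t + h"] by (simp add: mult_le_0_iff)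
  then have "s * ((y x (t + h) - y x t) / h) \<le> 0" using h by (simp add: divide_nonpos_pos)
  then show False using dt \<epsilon>(1) by linarith
qed

end

section \<open>The curvature estimate\<close>

text \<open>The limit \<open>h \<rightarrow> 0\<close> of \<open>react\<close> below, written with \<open>w = v p\<close>.\<close>
definition reaction :: "real \<Rightarrow> real \<Rightarrow> real \<Rightarrow> real \<Rightarrow> real \<Rightarrow> real \<Rightarrow> real \<Rightarrow> real" where
  "reaction A p v E y a \<beta> =
    p\<^sup>2 + 2 * A * (y - a * E) * (- y * p - a * (E * p / 2 - E * (y\<^sup>2 / 2 + v * p) / 2 / v)
      + 2 * \<beta> * (E * y / 2) / v) - 2 * A / v * (v * p - (\<beta> * E + a * (E * y / 2)))\<^sup>2"

text \<open>For \<open>A\<close> large the last square, of size \<open>2 A v p\<^sup>2\<close>, absorbs the reaction term \<open>p\<^sup>2\<close>.\<close>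
lemma reaction_negative:
  fixes e1 e2 Y \<alpha> b :: real
  assumes e1: "0 < e1" and e2: "0 \<le> e2" and Y: "0 \<le> Y" and \<alpha>: "0 \<le> \<alpha>" and b: "0 \<le> b"
  obtains K0 where "0 \<le> K0"
    "\<And>p v E y a \<beta>. e1 \<le> v \<Longrightarrow> v = E\<^sup>2 \<Longrightarrow> 0 < E \<Longrightarrow> E \<le> e2 \<Longrightarrow> \<bar>y\<bar> \<le> Y \<Longrightarrow> \<bar>a\<bar> \<le> \<alpha> \<Longrightarrow> \<bar>\<beta>\<bar> \<le> b \<Longrightarrow>
      p < - K0 \<Longrightarrow>
      reaction (2 / e1) p v E y a \<beta> < 0"
proof -
  \<comment> \<open>\<open>2 / e1\<close> makes \<open>A * v \<ge> 2\<close>, so the square yields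
    \<open>2 * p\<^sup>2\<close>: one copy cancels the reaction term, the other absorbs lower order
    terms. \<open>D\<close>, \<open>Pm\<close> and \<open>B\<close> will bound \<open>d\<close>,
    \<open>P\<close> and \<open>R\<close>.\<close>
  define A where "A = 2 / e1"
  define D where "D = b * e2 + \<alpha> * (e2 * Y / 2)"
  define Pm where "Pm = Y + \<alpha> * e2"
  define B where "B = (\<alpha> * e2 * Y\<^sup>2 / 4 + b * e2 * Y) / e1"
  define C1 where "C1 = 2 * A * Pm * Y"
  define C2 where "C2 = 2 * A * Pm * B + 2 * A * D\<^sup>2 / e1"
  have A: "0 < A" using e1 by (simp add: A_def)
  have nn: "0 \<le> D" "0 \<le> Pm" "0 \<le> B" using e1 e2 Y \<alpha> b by (auto simp: D_def Pm_def B_def)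
  have C: "0 \<le> C1" "0 \<le> C2" using nn A Y e1 by (auto simp: C1_def C2_def)
  show thesis
  proof (rule that[of "C1 + C2 + 1"])
    show "0 \<le> C1 + C2 + 1" using C by simp
    fix p v E y a \<beta> :: real
    assume v: "e1 \<le> v" "v = E\<^sup>2" and E: "0 < E" "E \<le> e2" and y: "\<bar>y\<bar> \<le> Y" and a: "\<bar>a\<bar> \<le> \<alpha>"
      and \<beta>: "\<bar>\<beta>\<bar> \<le> b" and p: "p < - (C1 + C2 + 1)"
    have vpos: "0 < v" using v(1) e1 by linarith
    define P where "P = y - a * E"
    define d where "d = \<beta> * E + a * (E * y / 2)"
    define R where "R = a * E * y\<^sup>2 / (4 * v) + \<beta> * E * y / v"
    have aE: "\<bar>a * E\<bar> \<le> \<alpha> * e2" using a E \<alpha> by (auto simp: abs_mult intro!: mult_mono)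
    have P: "\<bar>P\<bar> \<le> Pm" using aE y by (simp add: P_def Pm_def)
    have \<beta>E: "\<bar>\<beta> * E\<bar> \<le> b * e2" using \<beta> E b by (auto simp: abs_mult intro!: mult_mono)
    have "\<bar>a * E * y\<bar> \<le> \<alpha> * e2 * Y"
      using mult_mono[OF aE y] \<alpha> e2 by (simp add: abs_mult)
    then have d: "\<bar>d\<bar> \<le> D" using \<beta>E by (simp add: d_def D_def)
    have "y\<^sup>2 \<le> Y\<^sup>2" using y by (simp add: abs_le_square_iff[symmetric])
    then have "\<bar>a * E * y\<^sup>2\<bar> \<le> \<alpha> * e2 * Y\<^sup>2"
      using mult_mono[OF aE, of "y\<^sup>2" "Y\<^sup>2"] \<alpha> e2 by (simp add: abs_mult)
    moreover have "\<bar>\<beta> * E * y\<bar> \<le> b * e2 * Y"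
      using mult_mono[OF \<beta>E y] b e2 by (simp add: abs_mult)
    ultimately have "\<bar>a * E * y\<^sup>2 / 4 + \<beta> * E * y\<bar> \<le> \<alpha> * e2 * Y\<^sup>2 / 4 + b * e2 * Y" by linarith
    then have "\<bar>a * E * y\<^sup>2 / 4 + \<beta> * E * y\<bar> / v \<le> B"
      unfolding B_def using v e1 by (intro frac_le) auto
    moreover have "R = (a * E * y\<^sup>2 / 4 + \<beta> * E * y) / v" using vpos by (simp add: R_def field_simps)
    ultimately have R: "\<bar>R\<bar> \<le> B" using vpos by (simp add: abs_divide)
    \<comment> \<open>The terms in \<open>E * p\<close> from the time derivative and the second
      space derivative of \<open>E\<close> cancel, so the bracket is affine in \<open>p\<close> with
      slope \<open>- y\<close>.\<close>
    have bracket: "- y * p - a * (E * p / 2 - E * (y\<^sup>2 / 2 + v * p) / 2 / v) + 2 * \<beta> * (E * y / 2) / v = - y * p + R"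
      using vpos E by (simp add: R_def field_simps)
    have "\<bar>y * p\<bar> \<le> Y * \<bar>p\<bar>"
      unfolding abs_mult by (rule mult_right_mono[OF y]) simp
    then have "\<bar>- y * p + R\<bar> \<le> Y * \<bar>p\<bar> + B"
      using R by linarith
    then have "\<bar>P * (- y * p + R)\<bar> \<le> Pm * (Y * \<bar>p\<bar> + B)"
      unfolding abs_mult by (intro mult_mono P nn) auto
    then have "P * (- y * p + R) \<le> Pm * (Y * \<bar>p\<bar> + B)" by linarith
    then have "2 * A * (P * (- y * p + R)) \<le> 2 * A * (Pm * (Y * \<bar>p\<bar> + B))"
      using A by (intro mult_left_mono) auto
    then have t2: "2 * A * P * (- y * p + R) \<le> C1 * \<bar>p\<bar> + 2 * A * Pm * B"
      by (simp add: C1_def algebra_simps)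
    \<comment> \<open>Young's inequality: half of the square of \<open>v * p\<close> survives at the
      cost of the square of \<open>d\<close>.\<close>
    have "0 \<le> (v * p - 2 * d)\<^sup>2" by simp
    then have sq: "v\<^sup>2 * p\<^sup>2 / 2 - d\<^sup>2 \<le> (v * p - d)\<^sup>2"
      by (simp add: power2_eq_square algebra_simps)
    have "2 * A / v * (v\<^sup>2 * p\<^sup>2 / 2 - d\<^sup>2) \<le> 2 * A / v * (v * p - d)\<^sup>2"
      using sq A vpos by (intro mult_left_mono) auto
    moreover have "2 * A / v * (v\<^sup>2 * p\<^sup>2 / 2 - d\<^sup>2) = A * v * p\<^sup>2 - 2 * A * d\<^sup>2 / v"
      using vpos by (simp add: field_simps power2_eq_square)
    moreover have "2 * A * d\<^sup>2 / v \<le> 2 * A * D\<^sup>2 / e1"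
    proof (intro frac_le mult_left_mono)
      show "d\<^sup>2 \<le> D\<^sup>2" using d nn by (simp add: abs_le_square_iff[symmetric])
    qed (use A v e1 in auto)
    moreover have "2 * p\<^sup>2 \<le> A * v * p\<^sup>2"
      using v e1 by (intro mult_right_mono) (auto simp: A_def field_simps)
    ultimately have t3: "2 * p\<^sup>2 - 2 * A * D\<^sup>2 / e1 \<le> 2 * A / v * (v * p - d)\<^sup>2" by linarith
    \<comment> \<open>After the absorption \<open>- p\<^sup>2\<close> stands against
      \<open>C1 * \<bar>p\<bar> + C2\<close>, and the size of \<open>\<bar>p\<bar>\<close>
      decides.\<close>
    have "C1 + C2 + 1 < \<bar>p\<bar>" "1 \<le> \<bar>p\<bar>" using p C by auto
    then have "C1 * \<bar>p\<bar> + C2 < \<bar>p\<bar> * \<bar>p\<bar>"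
    proof -
      have "(C1 + C2 + 1) * \<bar>p\<bar> \<le> \<bar>p\<bar> * \<bar>p\<bar>" using p C by (intro mult_right_mono) auto
      moreover have "C2 * 1 \<le> C2 * \<bar>p\<bar>" using C \<open>1 \<le> \<bar>p\<bar>\<close> by (intro mult_left_mono) auto
      ultimately show ?thesis using \<open>1 \<le> \<bar>p\<bar>\<close> by (simp add: algebra_simps)
    qed
    then have "C1 * \<bar>p\<bar> + C2 < p\<^sup>2" by (simp add: power2_eq_square)
    then have "p\<^sup>2 + 2 * A * P * (- y * p + R) - 2 * A / v * (v * p - d)\<^sup>2 < 0"
      using t2 t3 by (simp add: C2_def)
    then show "reaction (2 / e1) p v E y a \<beta> < 0"
      unfolding reaction_def bracket P_def[symmetric] d_def[symmetric] A_def[symmetric] .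
  qed
qed

context log_diffusion
begin

section \<open>Evolution of the corrected curvature for averaged functions\<close>

lemma avg_difference_quotients:
  assumes "x \<in> {0..L}" "0 \<le> t" "0 < h" "t + h \<le> S"
  shows "avg p x t h = (z x (t + h) - z x t) / h" "avg w x t h = (v x (t + h) - v x t) / h"
    "avg Et x t h = (E x (t + h) - E x t) / h"
  using avg_eq_difference_quotient[of S z x p, OF p_t] avg_eq_difference_quotient[of S v x w, OF v_t]
    avg_eq_difference_quotient[of S E x Et, OF E_t] assms by auto

lemma avg_p_x:
  assumes "x \<in> {0..L}" "0 \<le> t" "0 < h" "t + h \<le> S"
  shows "((\<lambda>x. avg p x t h) has_real_derivative (y x (t + h) - y x t) / h) (at x within {0..L})"
proof -
  have "((\<lambda>x. (z x (t + h) - z x t) / h) has_real_derivative (y x (t + h) - y x t) / h) (at x within {0..L})"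
    by (intro DERIV_cdivide DERIV_diff z_x) (use assms in auto)
  then show ?thesis
    by (rule has_field_derivative_transform_within[where d = 1]) (use assms avg_difference_quotients in auto)
qed

text \<open>\<open>aff\<close> interpolates the boundary coefficients, so both boundary conditions
  read \<open>y = aff x * E\<close>, and \<open>P\<close> is the averaged defect of this relation.
  \<open>Px\<close> and \<open>Pxx\<close> are its space derivatives; the leading term of
  \<open>Pxx\<close> is a difference quotient of \<open>v * y\<close>, the space derivative of
  \<open>v\<close>.\<close>

definition "aff x = c0 + (cL - c0) / L * x"
definition "P x t h = avg y x t h - aff x * avg E x t h"
definition "Px x t h = avg w x t h - ((cL - c0) / L * avg E x t h + aff x * avg E' x t h)"
definition "Pxx x t h = (v x (t + h) * y x (t + h) - v x t * y x t) / h
  - (2 * ((cL - c0) / L) * avg E' x t h + aff x * avg E'' x t h)"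

lemma aff_x: "(aff has_real_derivative (cL - c0) / L) (at x within X)"
  unfolding aff_def[abs_def]
  by (rule DERIV_add[OF DERIV_const DERIV_cmult_Id, THEN DERIV_cong]) simp

lemma aff_ends: "aff 0 = c0" "aff L = cL"
  using L by (auto simp: aff_def)

lemma aff_bound: assumes "x \<in> {0..L}" shows "\<bar>aff x\<bar> \<le> c0 - cL"
proof -
  have "0 \<le> x / L" "x / L \<le> 1" using assms L by auto
  then have "(c0 - cL) * 0 \<le> (c0 - cL) * (x / L)" "(c0 - cL) * (x / L) \<le> (c0 - cL) * 1"
    using c0 cL by (intro mult_left_mono; simp)+
  moreover have "aff x = c0 - (c0 - cL) * (x / L)" using less_imp_neq[OF L] by (simp add: aff_def field_simps)
  ultimately show ?thesis using c0 cL by auto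
qed

lemma P_x:
  assumes "x \<in> {0..L}" "0 \<le> t" "0 < h" "t + h \<le> S"
  shows "((\<lambda>x. P x t h) has_real_derivative Px x t h) (at x within {0..L})"
    and "((\<lambda>x. Px x t h) has_real_derivative Pxx x t h) (at x within {0..L})"
proof -
  have E1: "((\<lambda>x. avg E x t h) has_real_derivative avg E' x t h) (at x within {0..L})"
    by (rule avg_has_derivative_space[OF _ cont'(2,4)]) (use assms E_x in auto)
  have E2: "((\<lambda>x. avg E' x t h) has_real_derivative avg E'' x t h) (at x within {0..L})"
    by (rule avg_has_derivative_space[OF _ cont'(4,5)]) (use assms E'_x in auto)
  have w: "avg w x t h = (v x (t + h) - v x t) / h" if "x \<in> {0..L}" for x
    using avg_difference_quotients(2) that assms by auto
  show "((\<lambda>x. P x t h) has_real_derivative Px x t h) (at x within {0..L})"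
    unfolding P_def Px_def
    using DERIV_diff[OF avg_y_x(1)[OF assms] DERIV_mult[OF aff_x E1]] w[OF assms(1)]
    by (simp add: algebra_simps)
  have "((\<lambda>x. (v x (t + h) - v x t) / h) has_real_derivative
      (v x (t + h) * y x (t + h) - v x t * y x t) / h) (at x within {0..L})"
    by (rule avg_y_x(2)[OF assms])
  then have wx: "((\<lambda>x. avg w x t h) has_real_derivative
      (v x (t + h) * y x (t + h) - v x t * y x t) / h) (at x within {0..L})"
    by (rule has_field_derivative_transform_within[where d = 1]) (use assms w in auto)
  show "((\<lambda>x. Px x t h) has_real_derivative Pxx x t h) (at x within {0..L})"
    unfolding Px_def Pxx_def
    using DERIV_diff[OF wx DERIV_add[OF DERIV_cmult[OF E1, of "(cL - c0) / L"] DERIV_mult[OF aff_x E2]]]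
    by (simp add: algebra_simps)
qed

lemma P_t:
  assumes "x \<in> {0..L}" "t \<in> {0..t1}" "0 < h" "t1 + h \<le> S"
  shows "((\<lambda>t. P x t h) has_real_derivative
      (y x (t + h) - y x t) / h - aff x * ((E x (t + h) - E x t) / h)) (at t within {0..t1})"
  unfolding P_def
  by (intro DERIV_diff DERIV_cmult
      avg_has_derivative_time[where F = y and x = x, OF cont_time[OF cont(2) assms(1)] assms(2-4)]
      avg_has_derivative_time[where F = E and x = x, OF cont_time[OF cont'(2) assms(1)] assms(2-4)])

text \<open>The relation \<open>y = aff x * E\<close> is linear in the pair \<open>y\<close>,
  \<open>E\<close> and so survives averaging; this is why \<open>E\<close> itself is averaged
  instead of being recomputed from an average of \<open>z\<close>.\<close>

lemma P_boundary:
  assumes "0 \<le> t" "0 \<le> h" "t + h \<le> S" "x = 0 \<or> x = L"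
  shows "P x t h = 0"
proof -
  have "y x (t + h * \<sigma>) = aff x * E x (t + h * \<sigma>)" if "\<sigma> \<in> {0..1}" for \<sigma>
    using shift_in_interval[OF assms(1-3), of \<sigma>] that assms(4) bc0 bcL aff_ends by (auto simp: E_def)
  then have "avg y x t h = integral {0..1} (\<lambda>\<sigma>. aff x * E x (t + h * \<sigma>))"
    unfolding avg_def by (intro integral_cong) auto
  then show ?thesis by (simp add: P_def avg_def)
qed

text \<open>\<open>Q\<^sub>t - Q\<^sub>x\<^sub>x / v\<close>, with \<open>v\<close> taken at \<open>t + h\<close>, for the function \<open>Q\<close> below.\<close>
definition "react A x t h = p x t * avg w x t h / v x (t + h)
  + 2 * A * P x t h * (- y x t * avg w x t h / v x (t + h)
      - aff x * (avg Et x t h - avg E'' x t h / v x (t + h))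
      + 2 * ((cL - c0) / L) * avg E' x t h / v x (t + h))
  - 2 * A / v x (t + h) * (Px x t h)\<^sup>2"

text \<open>The correction \<open>A P\<^sup>2\<close> to the curvature \<open>- p\<close> has zero conormal derivative because \<open>P = 0\<close> at both
  ends, while it contributes \<open>- 2 A P\<^sub>x\<^sup>2 / v\<close>, hence a multiple of \<open>- p\<^sup>2\<close>, to the evolution equation.\<close>
definition "Q A x t h = - avg p x t h + A * (P x t h)\<^sup>2"

text \<open>\<open>react\<close> is exactly \<open>dt - H / v'\<close>, where \<open>dt\<close> is
  the time derivative of \<open>Q\<close> and \<open>H\<close> its second space derivative; the
  tests at a maximum give the signs of both.\<close>

lemma react_nonneg_at_max:
  assumes x: "x \<in> {0..L}" and t: "0 < t" "t \<in> {0..t1}" and h: "0 < h" "t1 + h \<le> S"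
    and pos: "0 < Q A x t h"
    and max: "\<And>\<xi> \<tau>. \<xi> \<in> {0..L} \<Longrightarrow> \<tau> \<in> {0..t1} \<Longrightarrow> Q A \<xi> \<tau> h \<le> Q A x t h"
  shows "0 \<le> react A x t h"
proof -
  have th: "0 \<le> t" "t + h \<le> S" using t h by auto
  define y' v' w' E2 p' where "y' = y x (t + h)" and "v' = v x (t + h)" and "w' = w x (t + h)"
    and "E2 = E x (t + h)" and "p' = p x (t + h)"
  note defs = y'_def v'_def w'_def E2_def p'_def
  define dt where "dt = - ((p' - p x t) / h)
    + A * (2 * P x t h * ((y' - y x t) / h - aff x * ((E2 - E x t) / h)))"
  define H where "H = - ((w' - w x t) / h) + A * (2 * (Px x t h * Px x t h + P x t h * Pxx x t h))"
  have "((\<lambda>t. Q A x t h) has_real_derivative dt) (at t within {0..t1})"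
    unfolding Q_def dt_def defs
    by (rule DERIV_add[OF DERIV_minus[OF avg_has_derivative_time[where F = p and x = x, OF cont_time[OF cont'(3) x] t(2) h]]
          DERIV_cmult[OF DERIV_power[OF P_t[OF x t(2) h], where n = 2, THEN DERIV_cong]]]) simp
  then have dt: "0 \<le> dt"
    by (rule derivative_nonneg_at_max[OF t]) (use max x in auto)
  define G where "G \<xi> = - ((y \<xi> (t + h) - y \<xi> t) / h) + A * (2 * (P \<xi> t h * Px \<xi> t h))" for \<xi>
  have dQ: "((\<lambda>\<xi>. Q A \<xi> t h) has_real_derivative G \<xi>) (at \<xi> within {0..L})" if "\<xi> \<in> {0..L}" for \<xi>
    unfolding Q_def G_def
    by (rule DERIV_add[OF DERIV_minus[OF avg_p_x[OF that th(1) h(1) th(2)]]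
          DERIV_cmult[OF DERIV_power[OF P_x(1)[OF that th(1) h(1) th(2)], where n = 2, THEN DERIV_cong]]]) simp
  have dy: "((\<lambda>\<xi>. (y \<xi> (t + h) - y \<xi> t) / h) has_real_derivative (w' - w x t) / h) (at x within {0..L})"
    unfolding w'_def using x th h by (intro DERIV_cdivide DERIV_diff y_x) auto
  have dG: "(G has_real_derivative H) (at x within {0..L})"
    unfolding G_def[abs_def] H_def
    by (rule DERIV_add[OF DERIV_minus[OF dy] DERIV_cmult[OF DERIV_cmult[OF 
            DERIV_mult[OF P_x[OF x th(1) h(1) th(2)], THEN DERIV_cong]]]]) simp
  \<comment> \<open>\<open>P\<close> vanishes here, so \<open>0 < Q\<close> says that
    \<open>z\<close> drops over \<open>[t, t + h]\<close>. The boundary condition then gives the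
    space derivative of \<open>Q\<close> the sign of \<open>aff x\<close>, as the second derivative
    test demands.\<close>
  have bdy: "\<exists>k\<ge>0. G x = aff x * k" if "x = 0 \<or> x = L"
  proof (intro exI conjI)
    have P0: "P x t h = 0" using P_boundary[OF th(1) _ th(2)] h that by simp
    have "avg p x t h < 0" using pos P0 by (simp add: Q_def)
    then have "z x (t + h) < z x t"
      using avg_difference_quotients(1)[OF x th(1) h(1) th(2)] h by (simp add: divide_less_0_iff)
    then show "0 \<le> (E x t - E2) / h" using h by (simp add: E2_def E_def)
    have "y x (t + h) = aff x * E2" "y x t = aff x * E x t"
      using that bc0 bcL th h aff_ends unfolding E2_def E_def by auto
    then show "G x = aff x * ((E x t - E2) / h)"
      unfolding G_def P0 by (simp add: right_diff_distrib diff_divide_distrib)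
  qed
  have bdy0: "0 \<le> G x" if "x = 0"
    using bdy that aff_ends c0 by auto
  have bdyL: "G x \<le> 0" if "x = L"
    using bdy that aff_ends cL by (auto simp: mult_nonpos_nonneg)
  have H: "H \<le> 0"
    by (rule second_derivative_test_Neumann(2)[OF L x dQ dG]) (use max t bdy0 bdyL in auto)
  have v': "0 < v'" using v_pos by (simp add: v'_def)
  have ww: "avg w x t h = (v' - v x t) / h" "avg Et x t h = (E2 - E x t) / h"
    using avg_difference_quotients[OF x th(1) h(1) th(2)] by (simp_all add: defs)
  have w: "w' = v' * p'" "w x t = v x t * p x t" by (simp_all add: w_eq defs)
  \<comment> \<open>With \<open>v\<close> taken at \<open>t + h\<close> the difference quotients of
    \<open>p\<close> and \<open>y\<close>, uncontrolled as \<open>h \<rightarrow> 0\<close>, combine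
    into products with \<open>avg w\<close>, which is continuous up to \<open>h = 0\<close>.\<close>
  have e1: "- ((p' - p x t) / h) + (w' - w x t) / h / v' = p x t * avg w x t h / v'"
    using h v' by (simp add: w ww field_simps)
  have e2: "(y' - y x t) / h - (v' * y' - v x t * y x t) / h / v' = - y x t * avg w x t h / v'"
    using h v' by (simp add: ww field_simps)
  have "dt - H / v' = (- ((p' - p x t) / h) + (w' - w x t) / h / v')
     + 2 * A * P x t h * ((y' - y x t) / h - (v' * y' - v x t * y x t) / h / v'
       - aff x * (avg Et x t h - avg E'' x t h / v') + 2 * ((cL - c0) / L) * avg E' x t h / v')
     - 2 * A / v' * (Px x t h)\<^sup>2"
    unfolding dt_def H_def Pxx_def y'_def[symmetric] v'_def[symmetric] ww(2)
    by (simp add: add_divide_distrib diff_divide_distrib algebra_simps power2_eq_square)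
  also have "\<dots> = react A x t h"
    unfolding e1 e2 react_def v'_def[symmetric] by simp
  finally have "dt - H / v' = react A x t h" .
  moreover have "H / v' \<le> 0" using H v' by (rule divide_nonpos_pos)
  ultimately show ?thesis using dt by linarith
qed

lemma cont_avg:
  assumes "continuous_on ({0..L} \<times> {0..S}) (\<lambda>(x, t). F x t)"
  shows "continuous_on (({0..L} \<times> {0..t1}) \<times> {0..S - t1}) (\<lambda>q. avg F (fst (fst q)) (snd (fst q)) (snd q))"
  using continuous_on_avg[OF assms, of t1] by (simp add: split_def)

lemma cont_at_start:
  assumes "continuous_on ({0..L} \<times> {0..S}) (\<lambda>(x, t). F x t)" "t1 \<le> S"
  shows "continuous_on (({0..L} \<times> {0..t1}) \<times> {0..S - t1}) (\<lambda>q. F (fst (fst q)) (snd (fst q)))"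
  by (rule continuous_on_compose2[OF assms(1), of _ "\<lambda>q. fst q", unfolded split_def])
    (use assms(2) in \<open>auto intro!: continuous_intros\<close>)

lemma cont_at_end:
  assumes "continuous_on ({0..L} \<times> {0..S}) (\<lambda>(x, t). F x t)"
  shows "continuous_on (({0..L} \<times> {0..t1}) \<times> {0..S - t1}) (\<lambda>q. F (fst (fst q)) (snd (fst q) + snd q))"
  by (rule continuous_on_compose2[OF assms(1), of _ "\<lambda>q. (fst (fst q), snd (fst q) + snd q)", unfolded split_def fst_conv snd_conv])
    (auto intro!: continuous_intros)

lemma cont_aff: "continuous_on X (\<lambda>q. aff (fst (fst q)))"
  unfolding aff_def by (intro continuous_intros)

lemma cont_P:
  "continuous_on (({0..L} \<times> {0..t1}) \<times> {0..S - t1}) (\<lambda>q. P (fst (fst q)) (snd (fst q)) (snd q))"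
  "continuous_on (({0..L} \<times> {0..t1}) \<times> {0..S - t1}) (\<lambda>q. Px (fst (fst q)) (snd (fst q)) (snd q))"
  unfolding P_def Px_def by (intro continuous_intros cont_avg cont cont' cont_aff)+

lemma cont_Q:
  "continuous_on (({0..L} \<times> {0..t1}) \<times> {0..S - t1}) (\<lambda>q. Q A (fst (fst q)) (snd (fst q)) (snd q))"
  unfolding Q_def by (intro continuous_intros cont_avg cont' cont_P)

text \<open>Continuity includes \<open>h = 0\<close>, so the sign of \<open>react\<close> at maximum
  points with \<open>h > 0\<close> passes to their limit.\<close>

lemma cont_react:
  assumes "t1 \<le> S"
  shows "continuous_on (({0..L} \<times> {0..t1}) \<times> {0..S - t1}) (\<lambda>q. react A (fst (fst q)) (snd (fst q)) (snd q))"
  unfolding react_def using v_pos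
  by (intro continuous_intros cont_avg cont cont' cont_P cont_aff cont_at_start[OF _ assms] cont_at_end)
    (auto simp: less_imp_neq[symmetric])

lemma react_0:
  "react A x t 0 = reaction A (p x t) (v x t) (E x t) (y x t) (aff x) ((cL - c0) / L)"
  using v_pos[of x t]
  by (simp add: react_def reaction_def P_def Px_def Et_def E''_def E'_def w_eq power2_eq_square)

text \<open>If the bound fails, the limiting maximum point of \<open>Q\<close> has
  \<open>p < - (N + K0)\<close>. Hence it lies at positive time and the reaction is negative there,
  against the limit of \<open>react_nonneg_at_max\<close>. The last summand of the bound pays for
  the correction \<open>A * P\<^sup>2\<close>.\<close>

lemma curvature_le:
  assumes m: "\<And>x t. x \<in> {0..L} \<Longrightarrow> t \<in> {0..<S} \<Longrightarrow> m \<le> z x t"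
    and M: "\<And>x t. x \<in> {0..L} \<Longrightarrow> t \<in> {0..<S} \<Longrightarrow> z x t \<le> M"
    and Y: "\<And>x t. x \<in> {0..L} \<Longrightarrow> t \<in> {0..<S} \<Longrightarrow> \<bar>y x t\<bar> \<le> Y"
    and N: "0 \<le> N" "\<And>x. x \<in> {0..L} \<Longrightarrow> - p x 0 \<le> N"
    and K0: "0 \<le> K0" "\<And>p v E y a \<beta>. exp m \<le> v \<Longrightarrow> v = E\<^sup>2 \<Longrightarrow> 0 < E \<Longrightarrow> E \<le> exp (M / 2) \<Longrightarrow>
      \<bar>y\<bar> \<le> Y \<Longrightarrow> \<bar>a\<bar> \<le> c0 - cL \<Longrightarrow> \<bar>\<beta>\<bar> \<le> (c0 - cL) / L \<Longrightarrow> p < - K0 \<Longrightarrow>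
      reaction (2 / exp m) p v E y a \<beta> < 0"
    and x1: "x1 \<in> {0..L}" and t1: "t1 \<in> {0..<S}"
  shows "- p x1 t1 \<le> N + K0 + 2 / exp m * (Y + (c0 - cL) * exp (M / 2))\<^sup>2"
proof (rule ccontr)
  define A where "A = 2 / exp m"
  define B where "B = A * (Y + (c0 - cL) * exp (M / 2))\<^sup>2"
  have A: "0 < A" by (simp add: A_def)
  have B: "0 \<le> B" using A by (simp add: B_def)
  assume "\<not> ?thesis"
  then have gt: "N + K0 + B < - p x1 t1" by (simp add: A_def B_def)
  have E_le: "E x t \<le> exp (M / 2)" if "x \<in> {0..L}" "t \<in> {0..<S}" for x t
    using M[OF that] by (simp add: E_def)
  have P0: "A * (P x t 0)\<^sup>2 \<le> B" if xt: "x \<in> {0..L}" "t \<in> {0..<S}" for x t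
  proof -
    have "\<bar>aff x * E x t\<bar> \<le> (c0 - cL) * exp (M / 2)"
      unfolding abs_mult using aff_bound[OF xt(1)] E_le[OF xt] E_pos[of x t] by (intro mult_mono) auto
    then have "\<bar>P x t 0\<bar> \<le> Y + (c0 - cL) * exp (M / 2)"
      using Y[OF xt] by (simp add: P_def)
    then have "(P x t 0)\<^sup>2 \<le> (Y + (c0 - cL) * exp (M / 2))\<^sup>2"
      by (simp add: abs_le_square_iff[symmetric])
    then show ?thesis unfolding B_def using A by (intro mult_left_mono) auto
  qed
  have K: "compact ({0..L} \<times> {0..t1})" "{0..L} \<times> {0..t1} \<noteq> {}"
    using x1 t1 by (auto intro: compact_Times)
  have S1: "0 < S - t1" using t1 by simp
  have "continuous_on (({0..L} \<times> {0..t1}) \<times> {0..S - t1}) (\<lambda>(q, h). Q A (fst q) (snd q) h)"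
    using cont_Q by (simp add: split_def)
  from maximum_points_converge[OF K S1 this]
  obtain h q q' where h: "\<And>n. 0 < h n" "\<And>n::nat. h n \<le> S - t1" "h \<longlonglongrightarrow> 0"
    and q: "\<And>n. q n \<in> {0..L} \<times> {0..t1}"
      "\<And>n k. k \<in> {0..L} \<times> {0..t1} \<Longrightarrow> Q A (fst k) (snd k) (h n) \<le> Q A (fst (q n)) (snd (q n)) (h n)"
      "q \<longlonglongrightarrow> q'"
    and q': "q' \<in> {0..L} \<times> {0..t1}"
      "\<And>k. k \<in> {0..L} \<times> {0..t1} \<Longrightarrow> Q A (fst k) (snd k) 0 \<le> Q A (fst q') (snd q') 0"
    by blast
  obtain x' t' where xt': "q' = (x', t')" "x' \<in> {0..L}" "t' \<in> {0..t1}"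
    using q'(1) by auto
  have t'S: "t' \<in> {0..<S}" using xt' t1 by auto
  have "0 \<le> A * (P x1 t1 0)\<^sup>2" using A by simp
  then have "N + K0 + B < Q A x1 t1 0" unfolding Q_def avg_0 using gt by linarith
  also have "\<dots> \<le> Q A x' t' 0" using q'(2)[of "(x1, t1)"] x1 t1 xt' by simp
  finally have gt': "N + K0 + B < Q A x' t' 0" .
  then have p': "p x' t' < - (N + K0)" using P0[OF xt'(2) t'S] by (simp add: Q_def)
  then have t'pos: "0 < t'" using N(2)[OF xt'(2)] K0(1) xt'(3) by (cases "t' = 0") auto
  have lim: "(\<lambda>n. (q n, h n)) \<longlonglongrightarrow> (q', 0)" by (intro tendsto_intros q h)
  have mem: "(q', 0) \<in> ({0..L} \<times> {0..t1}) \<times> {0..S - t1}"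
    "(q n, h n) \<in> ({0..L} \<times> {0..t1}) \<times> {0..S - t1}" for n
    using q'(1) q(1)[of n] h(1,2)[of n] S1 by auto
  have limQ: "(\<lambda>n. Q A (fst (q n)) (snd (q n)) (h n)) \<longlonglongrightarrow> Q A x' t' 0"
    using continuous_on_tendsto_compose[OF cont_Q lim mem(1)] mem(2) xt' by simp
  have limR: "(\<lambda>n. react A (fst (q n)) (snd (q n)) (h n)) \<longlonglongrightarrow> react A x' t' 0"
    using continuous_on_tendsto_compose[OF cont_react lim mem(1)] mem(2) xt' t1 by simp
  have "\<forall>\<^sub>F n in sequentially. 0 < Q A (fst (q n)) (snd (q n)) (h n)"
    using order_tendstoD(1)[OF limQ, of 0] gt' N K0 B by simp
  moreover have "\<forall>\<^sub>F n in sequentially. 0 < snd (q n)"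
    using order_tendstoD(1)[OF tendsto_snd[OF q(3)], of 0] t'pos xt' by simp
  ultimately have "\<forall>\<^sub>F n in sequentially. 0 \<le> react A (fst (q n)) (snd (q n)) (h n)"
  proof eventually_elim
    case (elim n)
    have qn: "fst (q n) \<in> {0..L}" "snd (q n) \<in> {0..t1}" using q(1)[of n] by (auto simp: mem_Times_iff)
    show ?case
    proof (rule react_nonneg_at_max[OF qn(1) elim(2) qn(2) h(1)])
      show "t1 + h n \<le> S" using h(2)[of n] by simp
      show "0 < Q A (fst (q n)) (snd (q n)) (h n)" by (rule elim(1))
      show "Q A \<xi> \<tau> (h n) \<le> Q A (fst (q n)) (snd (q n)) (h n)"
        if "\<xi> \<in> {0..L}" "\<tau> \<in> {0..t1}" for \<xi> \<tau>
        using q(2)[of "(\<xi>, \<tau>)" n] that by simp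
    qed
  qed
  then have "0 \<le> react A x' t' 0"
    using tendsto_lowerbound[OF limR] by simp
  moreover have "react A x' t' 0 < 0"
    unfolding react_0 A_def
  proof (rule K0(2))
    show "exp m \<le> v x' t'" using m[OF xt'(2) t'S] by (simp add: v_def)
    show "\<bar>(cL - c0) / L\<bar> \<le> (c0 - cL) / L" using c0 cL L by (simp add: abs_divide)
    show "p x' t' < - K0" using p' N by simp
  qed (use E_sq E_pos E_le xt' t'S Y aff_bound in auto)
  ultimately show False by simp
qed

end

text \<open>\<open>C\<close> is fixed before \<open>S\<close>, \<open>z\<close>, \<open>y\<close>
  and \<open>w\<close>, so it depends on the a priori bounds only and is uniform over all flows from
  one initial metric. Times stop short of \<open>S\<close> because averages look forward in
  time.\<close>

lemma log_diffusion_curvature_bound: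
  fixes L c0 cL m M Y N :: real
  assumes "0 < L" "0 \<le> c0" "cL \<le> 0" "0 \<le> Y" "0 \<le> N"
  obtains C where "0 \<le> C"
    "\<And>S z y w x t. log_diffusion L S c0 cL z y w \<Longrightarrow>
      (\<And>x t. x \<in> {0..L} \<Longrightarrow> t \<in> {0..<S} \<Longrightarrow> m \<le> z x t) \<Longrightarrow>
      (\<And>x t. x \<in> {0..L} \<Longrightarrow> t \<in> {0..<S} \<Longrightarrow> z x t \<le> M) \<Longrightarrow>
      (\<And>x t. x \<in> {0..L} \<Longrightarrow> t \<in> {0..<S} \<Longrightarrow> \<bar>y x t\<bar> \<le> Y) \<Longrightarrow>
      (\<And>x. x \<in> {0..L} \<Longrightarrow> - (w x 0 / exp (z x 0)) \<le> N) \<Longrightarrow>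
      x \<in> {0..L} \<Longrightarrow> t \<in> {0..<S} \<Longrightarrow> - (w x t / exp (z x t)) \<le> C"
proof -
  have "0 < exp m" "0 \<le> exp (M / 2)" "0 \<le> c0 - cL" "0 \<le> (c0 - cL) / L"
    using assms by auto
  from reaction_negative[OF this(1,2) assms(4) this(3,4)]
  obtain K0 where K0: "0 \<le> K0" "\<And>p v E y a \<beta>. exp m \<le> v \<Longrightarrow> v = E\<^sup>2 \<Longrightarrow> 0 < E \<Longrightarrow> E \<le> exp (M / 2) \<Longrightarrow>
      \<bar>y\<bar> \<le> Y \<Longrightarrow> \<bar>a\<bar> \<le> c0 - cL \<Longrightarrow> \<bar>\<beta>\<bar> \<le> (c0 - cL) / L \<Longrightarrow> p < - K0 \<Longrightarrow>
      reaction (2 / exp m) p v E y a \<beta> < 0"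
    by blast
  show thesis
  proof (rule that)
    show "0 \<le> N + K0 + 2 / exp m * (Y + (c0 - cL) * exp (M / 2))\<^sup>2" using assms K0(1) by simp
    fix S z y w x t
    assume *: "log_diffusion L S c0 cL z y w"
    then interpret log_diffusion L S c0 cL z y w .
    assume b: "\<And>x t. x \<in> {0..L} \<Longrightarrow> t \<in> {0..<S} \<Longrightarrow> m \<le> z x t"
      "\<And>x t. x \<in> {0..L} \<Longrightarrow> t \<in> {0..<S} \<Longrightarrow> z x t \<le> M"
      "\<And>x t. x \<in> {0..L} \<Longrightarrow> t \<in> {0..<S} \<Longrightarrow> \<bar>y x t\<bar> \<le> Y"
      and N: "\<And>x. x \<in> {0..L} \<Longrightarrow> - (w x 0 / exp (z x 0)) \<le> N"
      and xt: "x \<in> {0..L}" "t \<in> {0..<S}"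
    have "- p x 0 \<le> N" if "x \<in> {0..L}" for x using N[OF that] by (simp add: p_def v_def)
    from curvature_le[OF b assms(5) this K0 xt]
    show "- (w x t / exp (z x t)) \<le> N + K0 + 2 / exp m * (Y + (c0 - cL) * exp (M / 2))\<^sup>2"
      by (simp add: p_def v_def)
  qed
qed

section \<open>The normalised flow\<close>

lemma pd_r_eqI:
  assumes "0 < \<rho>" "r \<in> {-\<rho>..\<rho>}" "((\<lambda>s. h s t) has_real_derivative d) (at r within {-\<rho>..\<rho>})"
  shows "pd_r \<rho> h r t = d"
  unfolding pd_r_def cbox_interval[symmetric]
  by (rule vector_derivative_within_cbox)
    (use assms in \<open>auto simp: has_real_derivative_iff_has_vector_derivative\<close>)

lemma pd_r_has_derivative:
  assumes "(\<lambda>s. h s t) differentiable (at r within {-\<rho>..\<rho>})"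
  shows "((\<lambda>s. h s t) has_real_derivative pd_r \<rho> h r t) (at r within {-\<rho>..\<rho>})"
  using assms unfolding pd_r_def by (simp add: vector_derivative_works has_real_derivative_iff_has_vector_derivative)

locale profile =
  fixes f :: "real \<Rightarrow> real" and \<rho> :: real
  assumes \<rho>: "0 < \<rho>" and smooth: "smooth_profile f \<rho>" and f_pos': "\<forall>r\<in>{-\<rho>..\<rho>}. 0 < f r"
begin

abbreviation "I \<equiv> {-\<rho>..\<rho>}"

lemma f_pos: "r \<in> I \<Longrightarrow> 0 < f r"
  using f_pos' by auto

lemma f_derivs:
  assumes "r \<in> I"
  shows "(f has_real_derivative deriv f r) (at r within A)"
    and "(deriv f has_real_derivative deriv (deriv f) r) (at r within A)"
    and "deriv (deriv f) field_differentiable at r"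
proof -
  obtain U where U: "open U" "I \<subseteq> U" "\<And>n x. x \<in> U \<Longrightarrow> ((deriv ^^ n) f) differentiable (at x)"
    using smooth unfolding smooth_profile_def by auto
  have d: "((deriv ^^ n) f) field_differentiable (at r)" for n
    using U(3)[of r n] U(2) assms
    by (metis field_differentiable_def real_differentiableE subsetD)
  show "(f has_real_derivative deriv f r) (at r within A)"
    using d[of 0] by (simp add: field_differentiable_derivI has_field_derivative_at_within)
  show "(deriv f has_real_derivative deriv (deriv f) r) (at r within A)"
    using d[of 1] by (simp add: field_differentiable_derivI has_field_derivative_at_within)
  show "deriv (deriv f) field_differentiable at r"
    using d[of 2] by (simp add: numeral_2_eq_2)
qed

lemma f_cont: "continuous_on I f" "continuous_on I (deriv f)" "continuous_on I (deriv (deriv f))"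
proof -
  show "continuous_on I f" "continuous_on I (deriv f)"
    using f_derivs(1,2) by (meson DERIV_continuous_on)+
  show "continuous_on I (deriv (deriv f))"
    using f_derivs(3) by (meson continuous_at_imp_continuous_on field_differentiable_imp_continuous_at)
qed

end

locale flow = profile +
  fixes T :: real and u :: "real \<Rightarrow> real \<Rightarrow> real"
  assumes T: "0 < T" and flow: "normalised_flow f \<rho> T u"
begin

abbreviation "J \<equiv> {0..<T}"

lemma u_init: "r \<in> I \<Longrightarrow> u r 0 = 1"
  and u_pos: "r \<in> I \<Longrightarrow> t \<in> J \<Longrightarrow> 0 < u r t"
  and u_cont: "continuous_on (I \<times> J) (\<lambda>(r, t). u r t)"
    "continuous_on (I \<times> J) (\<lambda>(r, t). pd_r \<rho> u r t)"
    "continuous_on (I \<times> J) (\<lambda>(r, t). pd_r \<rho> (pd_r \<rho> u) r t)"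
  and area: "t \<in> J \<Longrightarrow> area f \<rho> u t = 1"
  and pde: "r \<in> I \<Longrightarrow> t \<in> J \<Longrightarrow> pd_t T u r t = (rbar f \<rho> u t - scal f \<rho> u r t) * u r t"
  and bc: "r \<in> {-\<rho>, \<rho>} \<Longrightarrow> t \<in> J \<Longrightarrow> kgeo f \<rho> u r t = kgeo0 f \<rho> r / sqrt (phi f \<rho> u t)"
  using flow unfolding normalised_flow_def by blast+

lemma u_derivs:
  assumes "r \<in> I" "t \<in> J"
  shows "((\<lambda>s. u s t) has_real_derivative pd_r \<rho> u r t) (at r within I)"
    and "((\<lambda>s. pd_r \<rho> u s t) has_real_derivative pd_r \<rho> (pd_r \<rho> u) r t) (at r within I)"
    and "(u r has_real_derivative pd_t T u r t) (at t within J)"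
proof -
  have d: "(\<lambda>s. u s t) differentiable (at r within I)" "(\<lambda>s. pd_r \<rho> u s t) differentiable (at r within I)"
    "(\<lambda>\<tau>. u r \<tau>) differentiable (at t within J)"
    using flow assms unfolding normalised_flow_def by blast+
  show "((\<lambda>s. u s t) has_real_derivative pd_r \<rho> u r t) (at r within I)"
    "((\<lambda>s. pd_r \<rho> u s t) has_real_derivative pd_r \<rho> (pd_r \<rho> u) r t) (at r within I)"
    using d(1,2) by (auto intro: pd_r_has_derivative)
  show "(u r has_real_derivative pd_t T u r t) (at t within J)"
    using d(3) unfolding pd_t_def by (simp add: vector_derivative_works has_real_derivative_iff_has_vector_derivative)
qed

text \<open>With \<open>ds = dr / f\<close>, the functions \<open>Y\<close> and \<open>f W\<close> are the first and second \<open>s\<close>-derivatives of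
  \<open>ln (u f\<^sup>2)\<close>; \<open>lr\<close> and \<open>lrr\<close> are those of \<open>ln u\<close> in \<open>r\<close>.\<close>
definition "lr r t = pd_r \<rho> u r t / u r t"
definition "lrr r t = (pd_r \<rho> (pd_r \<rho> u) r t * u r t - (pd_r \<rho> u r t)\<^sup>2) / (u r t)\<^sup>2"
definition "Y r t = 2 * deriv f r + f r * lr r t"
definition "W r t = - scal f \<rho> u r t * u r t * f r"

lemma ln_u_r:
  assumes "r \<in> I" "t \<in> J"
  shows "((\<lambda>s. ln (u s t)) has_real_derivative lr r t) (at r within I)"
    "((\<lambda>s. lr s t) has_real_derivative lrr r t) (at r within I)"
proof -
  show "((\<lambda>s. ln (u s t)) has_real_derivative lr r t) (at r within I)"
    using DERIV_chain2[OF DERIV_ln[OF u_pos[OF assms]] u_derivs(1)[OF assms]]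
    by (simp add: lr_def divide_inverse mult.commute)
  show "((\<lambda>s. lr s t) has_real_derivative lrr r t) (at r within I)"
    using DERIV_divide[OF u_derivs(2)[OF assms] u_derivs(1)[OF assms]] u_pos[OF assms]
    by (simp add: lr_def lrr_def power2_eq_square)
qed

lemma pd_r_ln_u: "r \<in> I \<Longrightarrow> t \<in> J \<Longrightarrow> pd_r \<rho> (\<lambda>r t. ln (u r t)) r t = lr r t"
  by (rule pd_r_eqI[OF \<rho>]) (use ln_u_r in auto)

lemma pd_rr_ln_u:
  assumes "r \<in> I" "t \<in> J"
  shows "pd_r \<rho> (pd_r \<rho> (\<lambda>r t. ln (u r t))) r t = lrr r t"
proof (rule pd_r_eqI[OF \<rho> assms(1)])
  show "((\<lambda>s. pd_r \<rho> (\<lambda>r t. ln (u r t)) s t) has_real_derivative lrr r t) (at r within I)"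
    by (rule has_field_derivative_transform_within[OF ln_u_r(2)[OF assms], where d = 1])
      (use assms pd_r_ln_u in auto)
qed

lemma W_eq:
  assumes "r \<in> I" "t \<in> J"
  shows "W r t = 2 * deriv (deriv f) r + f r * lrr r t + deriv f r * lr r t"
  using u_pos[OF assms] f_pos[OF assms(1)]
  by (simp add: W_def scal_def scal0_def lap0_def pd_r_ln_u[OF assms] pd_rr_ln_u[OF assms] field_simps)

lemma Y_r:
  assumes "r \<in> I" "t \<in> J"
  shows "((\<lambda>r. Y r t) has_real_derivative W r t) (at r within I)"
  unfolding Y_def W_eq[OF assms]
  by (rule DERIV_cong[OF DERIV_add[OF DERIV_cmult[OF f_derivs(2)] DERIV_mult[OF f_derivs(1) ln_u_r(2)]]])
    (use assms in auto)

lemma cont_fst: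
  assumes "continuous_on I g"
  shows "continuous_on (I \<times> J) (\<lambda>q. g (fst q))"
  by (rule continuous_on_compose2[OF assms]) (auto intro!: continuous_intros)

lemma cont_l:
  "continuous_on (I \<times> J) (\<lambda>q. lr (fst q) (snd q))" "continuous_on (I \<times> J) (\<lambda>q. lrr (fst q) (snd q))"
  using u_cont u_pos unfolding lr_def lrr_def split_def
  by (auto intro!: continuous_intros simp: less_imp_neq[symmetric])

lemma cont_Y: "continuous_on (I \<times> J) (\<lambda>(r, t). Y r t)"
  unfolding Y_def split_def by (intro continuous_intros cont_fst f_cont cont_l)

lemma cont_W: "continuous_on (I \<times> J) (\<lambda>(r, t). W r t)"
proof -
  have "continuous_on (I \<times> J) (\<lambda>q. 2 * deriv (deriv f) (fst q) + f (fst q) * lrr (fst q) (snd q)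
      + deriv f (fst q) * lr (fst q) (snd q))"
    by (intro continuous_intros cont_fst f_cont cont_l)
  then show ?thesis
    by (rule continuous_on_cong[THEN iffD1, rotated 2]) (auto simp: W_eq split_def)
qed

section \<open>Total curvature, boundary curvature and area along the flow\<close>

text \<open>Gauss--Bonnet on the annulus.\<close>
lemma rbar_eq:
  assumes "t \<in> J"
  shows "rbar f \<rho> u t = 2 * pi * (Y (-\<rho>) t - Y \<rho> t)"
proof -
  have "((\<lambda>r. W r t) has_integral (Y \<rho> t - Y (-\<rho>) t)) I"
    using \<rho> Y_r[OF _ assms]
    by (intro fundamental_theorem_of_calculus) (auto simp: has_real_derivative_iff_has_vector_derivative)
  then have "((\<lambda>r. - W r t) has_integral - (Y \<rho> t - Y (-\<rho>) t)) I"
    by (rule has_integral_neg)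
  then show ?thesis
    unfolding rbar_def by (simp add: W_def integral_unique)
qed

definition "\<Phi> t = integral {0..t} (rbar f \<rho> u)"

lemma phi_eq: "phi f \<rho> u t = exp (\<Phi> t)"
  by (simp add: phi_def \<Phi>_def)

text \<open>The exponent is half the logarithm of the unnormalised conformal factor, and its
  exponential is \<open>f * sqrt u / sqrt phi\<close>. Multiplying the geodesic curvature condition
  by \<open>2 * f * sqrt u\<close> therefore gives the claim, the sign \<open>nu\<close>
  cancelling.\<close>

lemma Y_boundary:
  assumes r: "r = -\<rho> \<or> r = \<rho>" and t: "t \<in> J"
  shows "Y r t = 2 * deriv f r / f r * exp ((ln (u r t) + 2 * ln (f r) - \<Phi> t) / 2)"
proof -
  have rI: "r \<in> I" and nu: "nu \<rho> r \<noteq> 0" using r \<rho> by (auto simp: nu_def)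
  have up: "0 < u r t" and fp: "0 < f r" using u_pos[OF rI t] f_pos[OF rI] by auto
  have "(nu \<rho> r * deriv f r / f r + nu \<rho> r * lr r t / 2) / sqrt (u r t)
      = nu \<rho> r * deriv f r / f r / sqrt (exp (\<Phi> t))"
    using bc[of r t] r t pd_r_ln_u[OF rI t] by (auto simp: kgeo_def kgeo0_def phi_eq)
  then have "nu \<rho> r * (deriv f r / f r + lr r t / 2)
      = nu \<rho> r * (deriv f r / f r * (sqrt (u r t) / sqrt (exp (\<Phi> t))))"
    using up by (simp add: field_simps)
  then have e: "deriv f r / f r + lr r t / 2 = deriv f r / f r * (sqrt (u r t) / sqrt (exp (\<Phi> t)))"
    by (rule mult_left_cancel[OF nu, THEN iffD1])
  have sq: "exp (ln c / 2) = sqrt c" if "0 < c" for c :: real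
  proof -
    have "exp (ln c / 2) = exp (ln (sqrt c))" using that by (simp add: ln_sqrt)
    then show ?thesis using that by simp
  qed
  have "exp ((ln (u r t) + 2 * ln (f r) - \<Phi> t) / 2) = exp (ln (u r t) / 2) * exp (ln (f r)) / exp (\<Phi> t / 2)"
    by (simp add: diff_divide_distrib add_divide_distrib exp_add exp_diff)
  also have "exp (\<Phi> t / 2) = sqrt (exp (\<Phi> t))" using sq[of "exp (\<Phi> t)"] by simp
  finally have "exp ((ln (u r t) + 2 * ln (f r) - \<Phi> t) / 2) = f r * (sqrt (u r t) / sqrt (exp (\<Phi> t)))"
    using up fp by (simp add: sq)
  moreover have "Y r t = 2 * f r * (deriv f r / f r + lr r t / 2)"
    using fp by (simp add: Y_def field_simps)
  ultimately show ?thesis using e by simp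
qed

text \<open>By Gauss-Bonnet the average curvature is read off from boundary values of
  \<open>Y\<close>, whose continuity in time is known.\<close>

lemma cont_rbar: "continuous_on J (rbar f \<rho> u)"
proof -
  have c: "continuous_on J (Y r)" if "r \<in> I" for r
    by (rule continuous_on_compose2[OF cont_Y, of _ "\<lambda>t. (r, t)", unfolded split_conv])
      (use that in \<open>auto intro!: continuous_intros\<close>)
  have "continuous_on J (\<lambda>t. 2 * pi * (Y (-\<rho>) t - Y \<rho> t))"
    using c \<rho> by (intro continuous_intros) auto
  then show ?thesis
    by (rule continuous_on_cong[THEN iffD1, rotated 2]) (auto simp: rbar_eq)
qed

lemma \<Phi>_t:
  assumes "t1 \<in> J" "t \<in> {0..t1}"
  shows "(\<Phi> has_real_derivative rbar f \<rho> u t) (at t within {0..t1})"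
  unfolding \<Phi>_def[abs_def]
  by (rule integral_has_real_derivative[OF continuous_on_subset[OF cont_rbar] assms(2)]) (use assms in auto)

lemma init:
  assumes "r \<in> I"
  shows "lr r 0 = 0" "lrr r 0 = 0"
proof -
  have d0: "pd_r \<rho> u r 0 = 0" if "r \<in> I" for r
  proof (rule pd_r_eqI[OF \<rho> that])
    show "((\<lambda>s. u s 0) has_real_derivative 0) (at r within I)"
      by (rule has_field_derivative_transform_within[OF DERIV_const[of 1], where d = 1])
        (use that u_init in auto)
  qed
  have "pd_r \<rho> (pd_r \<rho> u) r 0 = 0"
  proof (rule pd_r_eqI[OF \<rho> assms])
    show "((\<lambda>s. pd_r \<rho> u s 0) has_real_derivative 0) (at r within I)"
      by (rule has_field_derivative_transform_within[OF DERIV_const[of 0], where d = 1])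
        (use assms d0 in auto)
  qed
  then show "lr r 0 = 0" "lrr r 0 = 0" using d0[OF assms] by (simp_all add: lr_def lrr_def)
qed

text \<open>Unit area makes the mean of \<open>u * f\<close> over \<open>I\<close> equal to
  \<open>1 / (4 * pi * \<rho>)\<close>; half of it leaves room for a non-strict comparison of
  integrals.\<close>

lemma large_value:
  assumes "t \<in> J"
  shows "\<exists>r\<in>I. 1 / (8 * pi * \<rho>) \<le> u r t * f r"
proof (rule ccontr)
  assume "\<not> ?thesis"
  then have lt: "u r t * f r \<le> 1 / (8 * pi * \<rho>)" if "r \<in> I" for r
    using that by (meson linear)
  have "continuous_on I (\<lambda>r. u r t)"
    by (rule DERIV_continuous_on[OF u_derivs(1)[OF _ assms]])
  then have c: "continuous_on I (\<lambda>r. u r t * f r)"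
    by (intro continuous_on_mult f_cont)
  have "integral I (\<lambda>r. u r t * f r) \<le> integral I (\<lambda>r. 1 / (8 * pi * \<rho>))"
    by (rule integral_le[OF integrable_continuous_interval[OF c] _ lt]) auto
  also have "\<dots> = 1 / (4 * pi)" using \<rho> by (simp add: divide_simps)
  finally have "2 * pi * integral I (\<lambda>r. u r t * f r) \<le> 2 * pi * (1 / (4 * pi))"
    by (intro mult_left_mono) auto
  moreover have "2 * pi * (1 / (4 * pi)) = 1 / 2" by simp
  moreover have "2 * pi * integral I (\<lambda>r. u r t * f r) = 1"
    using area[OF assms] by (simp only: area_def)
  ultimately show False by linarith
qed

section \<open>Transfer to the unnormalised flow\<close>

text \<open>\<open>M\<close> bounds the initial value \<open>2 * ln (f r)\<close> of
  \<open>z\<close>. \<open>Y0\<close> bounds \<open>y\<close> initially and at the ends.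
  \<open>m\<close> combines \<open>large_value\<close>, the bound \<open>4 * pi * Y0 * T\<close> for
  \<open>\<Phi>\<close> and the oscillation \<open>Y0 * L\<close> of \<open>z\<close>. None of these
  involves \<open>u\<close>; the assumption on \<open>C\<close> is what
  \<open>log_diffusion_curvature_bound\<close> delivers.\<close>

lemma scal_le:
  fixes L Fm fm D N C :: real and R :: "real \<Rightarrow> real"
  defines "c0 \<equiv> 2 * deriv f (-\<rho>) / f (-\<rho>)" and "cL \<equiv> 2 * deriv f \<rho> / f \<rho>"
  defines "M \<equiv> 2 * ln Fm"
  defines "Y0 \<equiv> 2 * D + (c0 - cL) * exp (M / 2)"
  defines "m \<equiv> ln (fm / (8 * pi * \<rho>)) - 4 * pi * Y0 * T - Y0 * L"
  assumes L: "0 < L" and R_ends: "R 0 = -\<rho>" "R L = \<rho>"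
    and R_in: "\<And>s. s \<in> {0..L} \<Longrightarrow> R s \<in> I" and R_onto: "\<And>r. r \<in> I \<Longrightarrow> \<exists>s\<in>{0..L}. R s = r"
    and R_s: "\<And>s. s \<in> {0..L} \<Longrightarrow> (R has_real_derivative f (R s)) (at s within {0..L})"
    and fm: "0 < fm" "\<And>r. r \<in> I \<Longrightarrow> fm \<le> f r" and Fm: "\<And>r. r \<in> I \<Longrightarrow> f r \<le> Fm"
    and D: "\<And>r. r \<in> I \<Longrightarrow> \<bar>deriv f r\<bar> \<le> D" and N: "\<And>r. r \<in> I \<Longrightarrow> scal0 f r \<le> N"
    and c: "0 \<le> c0" "cL \<le> 0" and C0: "0 \<le> C"
    and C: "\<And>S z y w x t. log_diffusion L S c0 cL z y w \<Longrightarrow>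
      (\<And>x t. x \<in> {0..L} \<Longrightarrow> t \<in> {0..<S} \<Longrightarrow> m \<le> z x t) \<Longrightarrow>
      (\<And>x t. x \<in> {0..L} \<Longrightarrow> t \<in> {0..<S} \<Longrightarrow> z x t \<le> M) \<Longrightarrow>
      (\<And>x t. x \<in> {0..L} \<Longrightarrow> t \<in> {0..<S} \<Longrightarrow> \<bar>y x t\<bar> \<le> Y0) \<Longrightarrow>
      (\<And>x. x \<in> {0..L} \<Longrightarrow> - (w x 0 / exp (z x 0)) \<le> N) \<Longrightarrow>
      x \<in> {0..L} \<Longrightarrow> t \<in> {0..<S} \<Longrightarrow> - (w x t / exp (z x t)) \<le> C"
    and r: "r \<in> I" and t: "t \<in> {0<..<T}"
  shows "scal f \<rho> u r t \<le> C"
proof -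
  \<comment> \<open>The flow is controlled on the closed interval up to \<open>t1\<close>, and
    \<open>t\<close> stays strictly before its end, as the estimate requires.\<close>
  define t1 where "t1 = (t + T) / 2"
  have t1: "0 < t1" "t < t1" "t1 \<in> J" and sub: "{0..t1} \<subseteq> J" using t by (auto simp: t1_def)
  have \<Phi>_cont: "continuous_on {0..t1} \<Phi>"
    using \<Phi>_t[OF t1(3)] by (meson DERIV_continuous_on)
  have exp_cont: "continuous_on {0..t1} (\<lambda>t. exp (\<Phi> t))" by (intro continuous_intros \<Phi>_cont)
  \<comment> \<open>\<open>\<theta>\<close> maps unnormalised to normalised time, with speed
    \<open>phi\<close>.\<close>
  obtain S \<theta> where S: "0 < S" and \<theta>_ends: "\<theta> 0 = 0" "\<theta> S = t1"
    and \<theta>_in: "\<And>\<tau>. \<tau> \<in> {0..S} \<Longrightarrow> \<theta> \<tau> \<in> {0..t1}"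
    and \<theta>_onto: "\<And>t. t \<in> {0..t1} \<Longrightarrow> \<exists>\<tau>\<in>{0..S}. \<theta> \<tau> = t"
    and \<theta>_\<tau>: "\<And>\<tau>. \<tau> \<in> {0..S} \<Longrightarrow> (\<theta> has_real_derivative exp (\<Phi> (\<theta> \<tau>))) (at \<tau> within {0..S})"
    by (rule reparametrisation[OF t1(1) exp_cont exp_gt_zero]) blast
  have \<theta>_J: "\<theta> \<tau> \<in> J" if "\<tau> \<in> {0..S}" for \<tau> using \<theta>_in[OF that] sub by auto
  define Z where "Z r t = ln (u r t) + 2 * ln (f r) - \<Phi> t" for r t
  define z where "z s \<tau> = Z (R s) (\<theta> \<tau>)" for s \<tau>
  define y where "y s \<tau> = Y (R s) (\<theta> \<tau>)" for s \<tau>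
  define w where "w s \<tau> = W (R s) (\<theta> \<tau>) * f (R s)" for s \<tau>
  have expZ: "exp (Z r t) = u r t * (f r)\<^sup>2 / exp (\<Phi> t)" if "r \<in> I" "t \<in> J" for r t
    using u_pos[OF that] f_pos[OF that(1)]
    by (simp add: Z_def exp_diff exp_add exp_double)
  \<comment> \<open>Up to sign this is the unnormalised scalar curvature, \<open>phi\<close> times
    the normalised one.\<close>
  have rate: "w s \<tau> / exp (z s \<tau>) = - scal f \<rho> u (R s) (\<theta> \<tau>) * exp (\<Phi> (\<theta> \<tau>))"
    if "s \<in> {0..L}" "\<tau> \<in> {0..S}" for s \<tau>
    using u_pos[OF R_in \<theta>_J, OF that] f_pos[OF R_in, OF that(1)]
    by (simp add: w_def z_def W_def expZ[OF R_in \<theta>_J, OF that] power2_eq_square)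
  have R_sub: "R ` {0..L} \<subseteq> I" and \<theta>_sub: "\<theta> ` {0..S} \<subseteq> {0..t1}" using R_in \<theta>_in by auto
  have R_cont: "continuous_on {0..L} R" and \<theta>_cont: "continuous_on {0..S} \<theta>"
    using R_s \<theta>_\<tau> by (meson DERIV_continuous_on)+
  have comp: "continuous_on ({0..L} \<times> {0..S}) (\<lambda>(s, \<tau>). F (R s) (\<theta> \<tau>))"
    if "continuous_on (I \<times> {0..t1}) (\<lambda>(r, t). F r t)" for F :: "real \<Rightarrow> real \<Rightarrow> real"
  proof -
    have c: "continuous_on ({0..L} \<times> {0..S}) (\<lambda>q. (R (fst q), \<theta> (snd q)))"
      by (intro continuous_intros continuous_on_compose2[OF R_cont] continuous_on_compose2[OF \<theta>_cont]) auto
    show ?thesis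
      unfolding split_def
      by (rule continuous_on_compose2[OF that c, unfolded split_def fst_conv snd_conv])
        (use R_in \<theta>_in in auto)
  qed
  have sub': "I \<times> {0..t1} \<subseteq> I \<times> J" using sub by auto
  have Z_cont: "continuous_on (I \<times> {0..t1}) (\<lambda>(r, t). Z r t)"
    unfolding Z_def split_def
  proof (intro continuous_intros)
    show "continuous_on (I \<times> {0..t1}) (\<lambda>q. u (fst q) (snd q))"
      using continuous_on_subset[OF u_cont(1) sub'] by (simp add: split_def)
    show "continuous_on (I \<times> {0..t1}) (\<lambda>q. f (fst q))"
      by (rule continuous_on_subset[OF cont_fst[OF f_cont(1)] sub'])
    show "continuous_on (I \<times> {0..t1}) (\<lambda>q. \<Phi> (snd q))"
      by (rule continuous_on_compose2[OF \<Phi>_cont]) (auto intro!: continuous_intros)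
    show "\<forall>q\<in>I \<times> {0..t1}. u (fst q) (snd q) \<noteq> 0" "\<forall>q\<in>I \<times> {0..t1}. f (fst q) \<noteq> 0"
      using u_pos f_pos sub by (force simp: less_imp_neq[symmetric])+
  qed
  have WF_cont: "continuous_on (I \<times> {0..t1}) (\<lambda>(r, t). W r t * f r)"
    using continuous_on_subset[OF cont_W sub'] continuous_on_subset[OF cont_fst[OF f_cont(1)] sub']
    by (simp add: split_def continuous_on_mult)
  have LD: "log_diffusion L S c0 cL z y w"
  proof
    fix s \<tau> assume s: "s \<in> {0..L}" and \<tau>: "\<tau> \<in> {0..S}"
    note rI = R_in[OF s] and tJ = \<theta>_J[OF \<tau>]
    have dr: "((\<lambda>r. Z r (\<theta> \<tau>)) has_real_derivative
        lr (R s) (\<theta> \<tau>) + 2 * (inverse (f (R s)) * deriv f (R s)) - 0) (at (R s) within I)"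
      unfolding Z_def
      by (intro DERIV_diff DERIV_add DERIV_cmult DERIV_const ln_u_r(1)[OF rI tJ]
          DERIV_chain2[OF DERIV_ln[OF f_pos[OF rI]] f_derivs(1)[OF rI]])
    show "((\<lambda>s. z s \<tau>) has_real_derivative y s \<tau>) (at s within {0..L})"
      unfolding z_def y_def Y_def
      by (rule DERIV_cong[OF DERIV_chain_within[OF dr R_sub R_s[OF s]]])
        (use f_pos[OF rI] in \<open>simp add: field_simps\<close>)
    show "((\<lambda>s. y s \<tau>) has_real_derivative w s \<tau>) (at s within {0..L})"
      unfolding y_def w_def by (rule DERIV_chain_within[OF Y_r[OF rI tJ] R_sub R_s[OF s]])
    \<comment> \<open>The derivative of \<open>\<Phi>\<close> cancels the \<open>rbar\<close> of the
      normalised equation.\<close>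
    have dt: "((\<lambda>t. Z (R s) t) has_real_derivative
        inverse (u (R s) (\<theta> \<tau>)) * pd_t T u (R s) (\<theta> \<tau>) + 0 - rbar f \<rho> u (\<theta> \<tau>)) (at (\<theta> \<tau>) within {0..t1})"
      unfolding Z_def
      by (intro DERIV_diff DERIV_add DERIV_const \<Phi>_t[OF t1(3) \<theta>_in[OF \<tau>]]
          DERIV_chain2[where g = "u (R s)" and x = "\<theta> \<tau>", OF DERIV_ln[OF u_pos[OF rI tJ]]] DERIV_subset[OF u_derivs(3)[OF rI tJ] sub])
    show "(z s has_real_derivative w s \<tau> / exp (z s \<tau>)) (at \<tau> within {0..S})"
      unfolding z_def[abs_def]
      by (rule DERIV_cong[OF DERIV_chain_within[OF dt \<theta>_sub \<theta>_\<tau>[OF \<tau>]]])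
        (use u_pos[OF rI tJ] in \<open>simp add: pde[OF rI tJ] rate[OF s \<tau>, unfolded z_def] field_simps\<close>)
  next
    show "continuous_on ({0..L} \<times> {0..S}) (\<lambda>(s, \<tau>). z s \<tau>)"
      unfolding z_def by (rule comp[OF Z_cont])
    show "continuous_on ({0..L} \<times> {0..S}) (\<lambda>(s, \<tau>). y s \<tau>)"
      unfolding y_def by (rule comp[OF continuous_on_subset[OF cont_Y sub']])
    show "continuous_on ({0..L} \<times> {0..S}) (\<lambda>(s, \<tau>). w s \<tau>)"
      unfolding w_def by (rule comp[OF WF_cont])
  next
    fix \<tau> assume "\<tau> \<in> {0..S}"
    from \<theta>_J[OF this] show "y 0 \<tau> = c0 * exp (z 0 \<tau> / 2)" "y L \<tau> = cL * exp (z L \<tau> / 2)"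
      using Y_boundary[of "-\<rho>" "\<theta> \<tau>"] Y_boundary[of \<rho> "\<theta> \<tau>"]
      by (simp_all add: y_def z_def Z_def R_ends c0_def cL_def)
  qed (use L c in auto)
  then interpret LD: log_diffusion L S c0 cL z y w .
  have D0: "0 \<le> D" using D[of \<rho>] \<rho> by force
  have Fm_pos: "0 < Fm" using f_pos[of \<rho>] Fm[of \<rho>] \<rho> by force
  have z_le: "z s \<tau> \<le> M" if "s \<in> {0..L}" "\<tau> \<in> {0..S}" for s \<tau>
  proof (rule LD.le_initial[OF _ that])
    fix s assume "s \<in> {0..L}"
    from R_in[OF this] show "z s 0 \<le> M"
      using u_init Fm f_pos[of "R s"] Fm_pos by (simp add: z_def Z_def \<theta>_ends \<Phi>_def M_def)
  qed
  have E_le: "exp (z s \<tau> / 2) \<le> exp (M / 2)" if "s \<in> {0..L}" "\<tau> \<in> {0..S}" for s \<tau>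
    using z_le[OF that] by simp
  have y0: "0 \<le> y 0 \<tau>" "y 0 \<tau> \<le> Y0" and yL: "y L \<tau> \<le> 0" "- Y0 \<le> y L \<tau>" if \<tau>: "\<tau> \<in> {0..S}" for \<tau>
  proof -
    have "c0 * exp (z 0 \<tau> / 2) \<le> c0 * exp (M / 2)" "- cL * exp (z L \<tau> / 2) \<le> - cL * exp (M / 2)"
      using E_le[OF _ \<tau>] L c by (intro mult_left_mono; simp)+
    moreover have "0 \<le> c0 * exp (z 0 \<tau> / 2)" "0 \<le> - cL * exp (z L \<tau> / 2)" "0 \<le> c0 * exp (M / 2)" "0 \<le> - cL * exp (M / 2)"
      using c by (intro mult_nonneg_nonneg; simp)+
    ultimately show "0 \<le> y 0 \<tau>" "y 0 \<tau> \<le> Y0" "y L \<tau> \<le> 0" "- Y0 \<le> y L \<tau>"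
      using D0 by (simp_all add: LD.bc0[OF \<tau>] LD.bcL[OF \<tau>] Y0_def left_diff_distrib)
  qed
  have Y0: "0 \<le> Y0" using y0[of 0] S by simp
  have y_init: "\<bar>y s 0\<bar> \<le> Y0" if "s \<in> {0..L}" for s
  proof -
    have "0 \<le> (c0 - cL) * exp (M / 2)" using c by simp
    then show ?thesis
      using D[OF R_in[OF that]] init(1)[OF R_in[OF that]] unfolding y_def Y_def \<theta>_ends Y0_def by auto
  qed
  have y_le: "\<bar>y s \<tau>\<bar> \<le> Y0" if s: "s \<in> {0..L}" and \<tau>: "\<tau> \<in> {0..<S}" for s \<tau>
  proof -
    have le: "k * y s \<tau> \<le> Y0" if k: "k = 1 \<or> k = -1" for k
    proof (rule LD.space_derivative_le[OF s])
      show "0 \<le> \<tau>" "\<tau> < S" using \<tau> by auto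
      show "k * y s 0 \<le> Y0" if "s \<in> {0..L}" for s
        using y_init[OF that] k by auto
      show "k * y 0 t \<le> Y0" "k * y L t \<le> Y0" if "t \<in> {0..S}" for t
        using y0[OF that] yL[OF that] Y0 k by auto
    qed
    show ?thesis using le[of 1] le[of "-1"] by (simp add: abs_le_iff)
  qed
  \<comment> \<open>By Gauss-Bonnet \<open>rbar\<close> is \<open>2 * pi\<close> times
    \<open>y 0 \<tau> - y L \<tau>\<close>, and the boundary signs put \<open>y 0 \<tau>\<close> and
    \<open>- y L \<tau>\<close> between 0 and \<open>Y0\<close>.\<close>
  have rbar: "0 \<le> rbar f \<rho> u \<sigma>" "rbar f \<rho> u \<sigma> \<le> 4 * pi * Y0" if \<sigma>: "\<sigma> \<in> {0..t1}" for \<sigma>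
  proof -
    obtain \<tau> where \<tau>: "\<tau> \<in> {0..S}" "\<theta> \<tau> = \<sigma>" using \<theta>_onto[OF \<sigma>] by auto
    have eq: "rbar f \<rho> u \<sigma> = 2 * pi * (y 0 \<tau> - y L \<tau>)"
      using rbar_eq[of \<sigma>] \<sigma> sub \<tau> by (auto simp: y_def R_ends)
    show "0 \<le> rbar f \<rho> u \<sigma>" unfolding eq using y0[OF \<tau>(1)] yL[OF \<tau>(1)] by simp
    have "2 * pi * (y 0 \<tau> - y L \<tau>) \<le> 2 * pi * (2 * Y0)"
      using y0[OF \<tau>(1)] yL[OF \<tau>(1)] by (intro mult_left_mono) auto
    then show "rbar f \<rho> u \<sigma> \<le> 4 * pi * Y0" unfolding eq by simp
  qed
  have \<Phi>_bounds: "0 \<le> \<Phi> \<sigma>" "\<Phi> \<sigma> \<le> 4 * pi * Y0 * T" if \<sigma>: "\<sigma> \<in> {0..t1}" for \<sigma>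
  proof -
    have "0 \<le> \<Phi> \<sigma> \<and> \<Phi> \<sigma> \<le> 4 * pi * Y0 * T"
    proof (cases "\<sigma> = 0")
      case True
      then show ?thesis using Y0 T by (simp add: \<Phi>_def)
    next
      case False
      then obtain \<xi> where \<xi>: "0 < \<xi>" "\<xi> < \<sigma>" "\<Phi> \<sigma> - \<Phi> 0 = rbar f \<rho> u \<xi> * (\<sigma> - 0)"
        using mvt_within[of 0 \<sigma> "{0..t1}" \<Phi> "rbar f \<rho> u"] \<sigma> \<Phi>_t[OF t1(3)] by auto
      have "\<xi> \<in> {0..t1}" using \<xi> \<sigma> by auto
      note b = rbar[OF this]
      have "rbar f \<rho> u \<xi> * \<sigma> \<le> 4 * pi * Y0 * T"
        using b Y0 \<sigma> t1(3) by (intro mult_mono) auto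
      then show ?thesis using \<xi> b \<sigma> by (simp add: \<Phi>_def)
    qed
    then show "0 \<le> \<Phi> \<sigma>" "\<Phi> \<sigma> \<le> 4 * pi * Y0 * T" by auto
  qed
  \<comment> \<open>Unit area gives a point where \<open>u * f\<^sup>2\<close> is not small, the
    bound on \<open>\<Phi>\<close> turns this into a bound for \<open>z\<close>, and the bound on
    \<open>y\<close> spreads it over the interval.\<close>
  have z_ge: "m \<le> z s \<tau>" if s: "s \<in> {0..L}" and \<tau>: "\<tau> \<in> {0..<S}" for s \<tau>
  proof -
    have \<tau>': "\<tau> \<in> {0..S}" using \<tau> by simp
    obtain r0 where r0: "r0 \<in> I" "1 / (8 * pi * \<rho>) \<le> u r0 (\<theta> \<tau>) * f r0"
      using large_value[OF \<theta>_J[OF \<tau>']] by blast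
    obtain s0 where s0: "s0 \<in> {0..L}" "R s0 = r0" using R_onto[OF r0(1)] by auto
    have k: "0 < fm / (8 * pi * \<rho>)" using fm(1) \<rho> by simp
    have "fm / (8 * pi * \<rho>) = 1 / (8 * pi * \<rho>) * fm" by simp
    also have "\<dots> \<le> (u r0 (\<theta> \<tau>) * f r0) * f r0"
      using r0 fm u_pos[OF r0(1) \<theta>_J[OF \<tau>']] f_pos[OF r0(1)] by (intro mult_mono) auto
    finally have "ln (fm / (8 * pi * \<rho>)) \<le> ln (u r0 (\<theta> \<tau>) * f r0 * f r0)"
      using k by simp
    also have "\<dots> = z s0 \<tau> + \<Phi> (\<theta> \<tau>)"
      using u_pos[OF r0(1) \<theta>_J[OF \<tau>']] f_pos[OF r0(1)] by (simp add: z_def Z_def s0 ln_mult)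
    finally have "ln (fm / (8 * pi * \<rho>)) - 4 * pi * Y0 * T \<le> z s0 \<tau>"
      using \<Phi>_bounds(2)[OF \<theta>_in[OF \<tau>']] by linarith
    moreover have "\<bar>z s0 \<tau> - z s \<tau>\<bar> \<le> Y0 * \<bar>s0 - s\<bar>"
      using lipschitz_within[of 0 L "\<lambda>s. z s \<tau>" "\<lambda>s. y s \<tau>" Y0 s0 s] LD.z_x[OF _ \<tau>'] y_le[OF _ \<tau>] s0 s
      by auto
    moreover have "Y0 * \<bar>s0 - s\<bar> \<le> Y0 * L" using s0 s Y0 by (intro mult_left_mono) auto
    ultimately show ?thesis by (simp add: m_def)
  qed
  have init_rate: "- (w s 0 / exp (z s 0)) \<le> N" if "s \<in> {0..L}" for s
  proof -
    note rI = R_in[OF that]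
    have "scal f \<rho> u (R s) 0 * (u (R s) 0 * f (R s)) = scal0 f (R s) * f (R s)"
      using W_eq[OF rI, of 0] T init[OF rI] f_pos[OF rI] by (simp add: W_def scal0_def)
    then have "scal f \<rho> u (R s) 0 = scal0 f (R s)" using u_init[OF rI] f_pos[OF rI] by simp
    then show ?thesis
      using rate[OF that, of 0] N[OF rI] S by (simp add: \<theta>_ends \<Phi>_def)
  qed
  obtain s where s: "s \<in> {0..L}" "R s = r" using R_onto[OF r] by auto
  obtain \<tau> where \<tau>: "\<tau> \<in> {0..S}" "\<theta> \<tau> = t" using \<theta>_onto[of t] t t1 by auto
  have \<tau>S: "\<tau> \<in> {0..<S}" using \<tau> \<theta>_ends t1 by (cases "\<tau> = S") auto
  have "- (w s \<tau> / exp (z s \<tau>)) \<le> C"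
    by (rule C[OF LD z_ge _ y_le init_rate s(1) \<tau>S]) (use z_le in auto)
  then have le: "scal f \<rho> u r t * exp (\<Phi> t) \<le> C"
    by (simp add: rate[OF s(1) \<tau>(1)] s \<tau>)
  \<comment> \<open>Undoing the rescaling only helps: \<open>exp (\<Phi> t) \<ge> 1\<close> settles
    nonnegative curvature, and \<open>0 \<le> C\<close> the rest.\<close>
  show ?thesis
  proof (cases "0 \<le> scal f \<rho> u r t")
    case True
    have "1 \<le> exp (\<Phi> t)" using \<Phi>_bounds(1)[of t] t t1 by simp
    from mult_left_mono[OF this True] show ?thesis using le by simp
  qed (use C0 in simp)
qed

end

theorem theorem3p1:
  fixes f :: "real \<Rightarrow> real" and \<rho> T :: real
  assumes "0 < \<rho>"
    and "smooth_profile f \<rho>"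
    and "\<forall>r\<in>{-\<rho>..\<rho>}. 0 < f r"
    and "2 * pi * integral {-\<rho>..\<rho>} f = 1"
    and "\<forall>r\<in>{-\<rho>..\<rho>}. 0 \<le> scal0 f r"
    and "\<forall>r\<in>{-\<rho>, \<rho>}. kgeo0 f \<rho> r \<le> 0"
  shows "\<exists>C. \<forall>u. normalised_flow f \<rho> T u \<longrightarrow>
           (\<forall>r\<in>{-\<rho>..\<rho>}. \<forall>t\<in>{0<..<T}. scal f \<rho> u r t \<le> C)"
proof (cases "0 < T")
  case T: True
  interpret profile f \<rho> using assms by unfold_locales
  have ends: "-\<rho> \<in> I" "\<rho> \<in> I" "I \<noteq> {}" "-\<rho> < \<rho>" using \<rho> by auto
  obtain L R where L: "0 < L" "R 0 = -\<rho>" "R L = \<rho>" "\<And>s. s \<in> {0..L} \<Longrightarrow> R s \<in> I"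
    "\<And>r. r \<in> I \<Longrightarrow> \<exists>s\<in>{0..L}. R s = r"
    "\<And>s. s \<in> {0..L} \<Longrightarrow> (R has_real_derivative f (R s)) (at s within {0..L})"
    using reparametrisation[OF ends(4) f_cont(1) f_pos] by blast
  obtain rm where rm: "rm \<in> I" "\<And>r. r \<in> I \<Longrightarrow> f rm \<le> f r"
    using continuous_attains_inf[OF compact_Icc ends(3) f_cont(1)] by blast
  obtain rM where rM: "rM \<in> I" "\<And>r. r \<in> I \<Longrightarrow> f r \<le> f rM"
    using continuous_attains_sup[OF compact_Icc ends(3) f_cont(1)] by blast
  have "continuous_on I (\<lambda>r. \<bar>deriv f r\<bar>)" by (intro continuous_intros f_cont)
  then obtain rD where rD: "\<And>r. r \<in> I \<Longrightarrow> \<bar>deriv f r\<bar> \<le> \<bar>deriv f rD\<bar>"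
    using continuous_attains_sup[OF compact_Icc ends(3)] by blast
  have "continuous_on I (scal0 f)"
    unfolding scal0_def using f_pos by (intro continuous_intros f_cont) force
  then obtain rN where rN: "rN \<in> I" "\<And>r. r \<in> I \<Longrightarrow> scal0 f r \<le> scal0 f rN"
    using continuous_attains_sup[OF compact_Icc ends(3)] by blast
  \<comment> \<open>Minus twice and twice the initial geodesic curvatures at the two ends: the
    outward normal is reversed at \<open>-\<rho>\<close>, so \<open>k_g \<le> 0\<close> gives
    opposite signs.\<close>
  define c0 where "c0 = 2 * deriv f (-\<rho>) / f (-\<rho>)"
  define cL where "cL = 2 * deriv f \<rho> / f \<rho>"
  have c: "0 \<le> c0" "cL \<le> 0"
    using assms(6) \<rho> f_pos[OF ends(1)] f_pos[OF ends(2)]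
    by (auto simp: kgeo0_def nu_def c0_def cL_def zero_le_divide_iff divide_le_0_iff)
  define M where "M = 2 * ln (f rM)"
  define Y0 where "Y0 = 2 * \<bar>deriv f rD\<bar> + (c0 - cL) * exp (M / 2)"
  have Y0: "0 \<le> Y0" using c by (simp add: Y0_def)
  have N: "0 \<le> scal0 f rN" using assms(5) rN by auto
  note params = c0_def cL_def M_def Y0_def
  \<comment> \<open>The parameters depend on \<open>f\<close>, \<open>\<rho>\<close> and
    \<open>T\<close> only, so \<open>C\<close> is obtained before a flow is fixed.\<close>
  show ?thesis
  proof (rule log_diffusion_curvature_bound[OF L(1) c Y0 N,
        where m = "ln (f rm / (8 * pi * \<rho>)) - 4 * pi * Y0 * T - Y0 * L" and M = M])
    fix C :: real
    assume C0: "0 \<le> C"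
    assume C: "\<And>S z y w x t. log_diffusion L S c0 cL z y w \<Longrightarrow>
      (\<And>x t. x \<in> {0..L} \<Longrightarrow> t \<in> {0..<S} \<Longrightarrow> ln (f rm / (8 * pi * \<rho>)) - 4 * pi * Y0 * T - Y0 * L \<le> z x t) \<Longrightarrow>
      (\<And>x t. x \<in> {0..L} \<Longrightarrow> t \<in> {0..<S} \<Longrightarrow> z x t \<le> M) \<Longrightarrow>
      (\<And>x t. x \<in> {0..L} \<Longrightarrow> t \<in> {0..<S} \<Longrightarrow> \<bar>y x t\<bar> \<le> Y0) \<Longrightarrow>
      (\<And>x. x \<in> {0..L} \<Longrightarrow> - (w x 0 / exp (z x 0)) \<le> scal0 f rN) \<Longrightarrow>
      x \<in> {0..L} \<Longrightarrow> t \<in> {0..<S} \<Longrightarrow> - (w x t / exp (z x t)) \<le> C"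
    show ?thesis
    proof (intro exI allI impI ballI)
      fix u r t assume u: "normalised_flow f \<rho> T u" and rt: "r \<in> I" "t \<in> {0<..<T}"
      interpret flow f \<rho> T u using T u by unfold_locales
      show "scal f \<rho> u r t \<le> C"
        by (rule scal_le[OF L f_pos[OF rm(1)] rm(2) rM(2) rD rN(2) c[unfolded params] C0 _ rt])
          (assumption | fact C[unfolded params])+
    qed
  qed
\<comment> \<open>For \<open>T \<le> 0\<close> the time interval is empty.\<close>
qed auto

end
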